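(* If $\mathrm{ZF}+\mathrm{VP}$ is consistent, then so is $\mathrm{ZF}_0+\mathrm{VP}+\neg\mathrm{Foundation}$, where $\mathrm{ZF}_0$ is $\mathrm{ZF}$ without the Foundation axiom. Similarly, if $\mathrm{ZFC}+\mathrm{VP}$ is consistent, then so is $\mathrm{ZFC}_0+\mathrm{VP}+\neg\mathrm{Foundation}$, where $\mathrm{ZFC}_0$ is $\mathrm{ZFC}$ without Foundation.
   Context: VP (Vopěnka's Principle) is the scheme, for each formula $\phi(x)$ of $\{\in\}$: for every set $A$, if the class $X_\phi=\{x:\phi(x)\}$ is a proper class (i.e. $(\forall x)(\exists y)[(\phi(y)\wedge y\notin x)\vee(\neg\phi(y)\wedge y\in x)]$) of $L_A$-structures, then there are distinct $\mathcal M,\mathcal N\in X_\phi$ and an elementary embedding $f:\mathcal M\to\mathcal N$. Here $L_A$ is the first-order language with equality, a unary predicate $\mathbf U$, a binary predicate $\mathbf R$ and a constant $\mathbf c_a$ for each $a\in A$, and an $L_A$-structure is $\langle M,U,R,I\rangle$ with $U\subseteq M$, $R\subseteq M\times M$, $I:A\to M$ interpreting $\mathbf c_a$ as $I(a)$. *)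

theory Defs
  imports Main
begin

section \<open>First-order logic in the language of set theory\<close>

text \<open>Formulas with equality and membership; variables are de Bruijn indices.\<close>

datatype fm = Eq nat nat | Mem nat nat | Fls | Imp fm fm | All fm

primrec ren :: "(nat \<Rightarrow> nat) \<Rightarrow> fm \<Rightarrow> fm" where
  "ren r (Eq i j) = Eq (r i) (r j)"
| "ren r (Mem i j) = Mem (r i) (r j)"
| "ren r Fls = Fls"
| "ren r (Imp p q) = Imp (ren r p) (ren r q)"
| "ren r (All p) = All (ren (case_nat 0 (\<lambda>i. Suc (r i))) p)"

text \<open>Instantiation of the outermost bound variable (index 0) by the variable \<open>i\<close>.\<close>

definition inst :: "nat \<Rightarrow> fm \<Rightarrow> fm" where
  "inst i p = ren (case_nat i (\<lambda>j. j)) p"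

text \<open>All free indices of \<open>p\<close> are below \<open>fv_bound p\<close>, which is least with this property.\<close>

primrec fv_bound :: "fm \<Rightarrow> nat" where
  "fv_bound (Eq i j) = max (Suc i) (Suc j)"
| "fv_bound (Mem i j) = max (Suc i) (Suc j)"
| "fv_bound Fls = 0"
| "fv_bound (Imp p q) = max (fv_bound p) (fv_bound q)"
| "fv_bound (All p) = fv_bound p - 1"

definition univ_closure :: "fm \<Rightarrow> fm" where
  "univ_closure p = (All ^^ fv_bound p) p"

text \<open>A Hilbert calculus for classical first-order logic with equality. The generalisation rule
  \<open>Gen\<close> is unrestricted, so \<open>T\<close> is meant to be a set of sentences.\<close>

inductive proves :: "fm set \<Rightarrow> fm \<Rightarrow> bool" for T where
  Ax: "p \<in> T \<Longrightarrow> proves T p"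
| K: "proves T (Imp p (Imp q p))"
| S: "proves T (Imp (Imp p (Imp q r)) (Imp (Imp p q) (Imp p r)))"
| DN: "proves T (Imp (Imp (Imp p Fls) Fls) p)"
| All_inst: "proves T (Imp (All p) (inst i p))"
| All_Imp: "proves T (Imp (All (Imp p q)) (Imp (All p) (All q)))"
| All_vac: "proves T (Imp p (All (ren Suc p)))"
| Eq_refl: "proves T (Eq i i)"
| Eq_subst: "proves T (Imp (Eq i j) (Imp (inst i p) (inst j p)))"
| MP: "proves T (Imp p q) \<Longrightarrow> proves T p \<Longrightarrow> proves T q"
| Gen: "proves T p \<Longrightarrow> proves T (All p)"

definition consistent :: "fm set \<Rightarrow> bool" where
  "consistent T \<longleftrightarrow> \<not> proves T Fls"


section \<open>Writing formulas with bound names and defined terms\<close>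

text \<open>
  A \<open>form\<close> is a formula as a function of its depth \<open>d\<close>, the number of quantifiers around it. The
  variable bound by the quantifier at depth \<open>l\<close> is known by its level \<open>l\<close>, which at depth \<open>d\<close> is
  the index \<open>d - Suc l\<close>; HOL binders can thus be used for the quantifiers. Indices from \<open>d\<close>
  onwards are free: they are parameters, bound later by \<open>univ_closure\<close>.

  A term is a variable or a description \<open>Desc Q\<close>, standing for the set with property \<open>Q\<close>. A
  description is eliminated in the atomic formula containing it: \<open>P (Desc Q)\<close> is
  \<open>\<exists>x. Q x \<and> P x\<close>. In \<open>elim_desc\<close> this \<open>x\<close> appears as its level, which is the depth \<open>d\<close>.
\<close>

type_synonym form = "nat \<Rightarrow> fm"

datatype trm = Var nat | Desc "nat \<Rightarrow> form"

definition fFls :: form ("\<^bold>\<bottom>") where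
  "\<^bold>\<bottom> = (\<lambda>d. Fls)"

definition fImp :: "form \<Rightarrow> form \<Rightarrow> form" (infixr "\<^bold>\<longrightarrow>" 25) where
  "(P \<^bold>\<longrightarrow> Q) = (\<lambda>d. Imp (P d) (Q d))"

definition fAll :: "(trm \<Rightarrow> form) \<Rightarrow> form" (binder "\<^bold>\<forall>" 10) where
  "(\<^bold>\<forall>x. F x) = (\<lambda>d. All (F (Var d) (Suc d)))"

definition fNot :: "form \<Rightarrow> form" ("\<^bold>\<not> _" [40] 40) where
  "(\<^bold>\<not> P) = (P \<^bold>\<longrightarrow> \<^bold>\<bottom>)"

definition fAnd :: "form \<Rightarrow> form \<Rightarrow> form" (infixr "\<^bold>\<and>" 35) where
  "(P \<^bold>\<and> Q) = (\<^bold>\<not> (P \<^bold>\<longrightarrow> \<^bold>\<not> Q))"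

definition fOr :: "form \<Rightarrow> form \<Rightarrow> form" (infixr "\<^bold>\<or>" 30) where
  "(P \<^bold>\<or> Q) = (\<^bold>\<not> P \<^bold>\<longrightarrow> Q)"

definition fIff :: "form \<Rightarrow> form \<Rightarrow> form" (infixr "\<^bold>\<longleftrightarrow>" 25) where
  "(P \<^bold>\<longleftrightarrow> Q) = ((P \<^bold>\<longrightarrow> Q) \<^bold>\<and> (Q \<^bold>\<longrightarrow> P))"

definition fEx :: "(trm \<Rightarrow> form) \<Rightarrow> form" (binder "\<^bold>\<exists>" 10) where
  "(\<^bold>\<exists>x. F x) = (\<^bold>\<not> (\<^bold>\<forall>x. \<^bold>\<not> F x))"

fun elim_desc :: "trm \<Rightarrow> (nat \<Rightarrow> form) \<Rightarrow> form" where
  "elim_desc (Var l) P = P l"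
| "elim_desc (Desc Q) P = (\<lambda>d. (\<^bold>\<exists>_. Q d \<^bold>\<and> P d) d)"

definition fEq :: "trm \<Rightarrow> trm \<Rightarrow> form" (infix "\<^bold>=" 50) where
  "(s \<^bold>= t) = elim_desc s (\<lambda>k. elim_desc t (\<lambda>l d. Eq (d - Suc k) (d - Suc l)))"

definition fMem :: "trm \<Rightarrow> trm \<Rightarrow> form" (infix "\<^bold>\<in>" 50) where
  "(s \<^bold>\<in> t) = elim_desc s (\<lambda>k. elim_desc t (\<lambda>l d. Mem (d - Suc k) (d - Suc l)))"

text \<open>The formula \<open>p\<close> with the variables of levels \<open>ls\<close> for its free indices
  \<open>0, 1, \<dots>, length ls - 1\<close>. Its remaining free variables become parameters.\<close>

definition app :: "fm \<Rightarrow> nat list \<Rightarrow> form" where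
  "app p ls = (\<lambda>d. ren (\<lambda>i. if i < length ls then d - Suc (ls ! i) else d + (i - length ls)) p)"

definition app1 :: "fm \<Rightarrow> trm \<Rightarrow> form" where
  "app1 p s = elim_desc s (\<lambda>k. app p [k])"

definition app2 :: "fm \<Rightarrow> trm \<Rightarrow> trm \<Rightarrow> form" where
  "app2 p s t = elim_desc s (\<lambda>k. elim_desc t (\<lambda>l. app p [k, l]))"

text \<open>The set of all \<open>w\<close> with \<open>P w\<close>.\<close>

definition coll :: "(trm \<Rightarrow> form) \<Rightarrow> trm" where
  "coll P = Desc (\<lambda>z. \<^bold>\<forall>w. w \<^bold>\<in> Var z \<^bold>\<longleftrightarrow> P w)"


section \<open>The axioms of set theory\<close>

definition zero :: trm where
  "zero = coll (\<lambda>w. \<^bold>\<bottom>)"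

definition adjoin :: "trm \<Rightarrow> trm \<Rightarrow> trm" where
  "adjoin s t = coll (\<lambda>w. w \<^bold>\<in> s \<^bold>\<or> w \<^bold>= t)"

definition suc :: "trm \<Rightarrow> trm" where
  "suc s = adjoin s s"

primrec num :: "nat \<Rightarrow> trm" where
  "num 0 = zero"
| "num (Suc k) = suc (num k)"

definition upair :: "trm \<Rightarrow> trm \<Rightarrow> trm" where
  "upair s t = coll (\<lambda>w. w \<^bold>= s \<^bold>\<or> w \<^bold>= t)"

definition opair :: "trm \<Rightarrow> trm \<Rightarrow> trm" ("\<langle>_,/ _\<rangle>") where
  "\<langle>s, t\<rangle> = upair (upair s s) (upair s t)"

definition is_fun :: "trm \<Rightarrow> trm \<Rightarrow> trm \<Rightarrow> form" where
  "is_fun f a b =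
    ((\<^bold>\<forall>z. z \<^bold>\<in> f \<^bold>\<longrightarrow> (\<^bold>\<exists>x. \<^bold>\<exists>y. x \<^bold>\<in> a \<^bold>\<and> y \<^bold>\<in> b \<^bold>\<and> z \<^bold>= \<langle>x, y\<rangle>)) \<^bold>\<and>
     (\<^bold>\<forall>x. x \<^bold>\<in> a \<^bold>\<longrightarrow> (\<^bold>\<exists>y. \<langle>x, y\<rangle> \<^bold>\<in> f \<^bold>\<and> (\<^bold>\<forall>y'. \<langle>x, y'\<rangle> \<^bold>\<in> f \<^bold>\<longrightarrow> y' \<^bold>= y))))"

definition is_inductive :: "trm \<Rightarrow> form" where
  "is_inductive w = (zero \<^bold>\<in> w \<^bold>\<and> (\<^bold>\<forall>x. x \<^bold>\<in> w \<^bold>\<longrightarrow> suc x \<^bold>\<in> w))"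

definition Extensionality :: fm where
  "Extensionality = univ_closure ((\<^bold>\<forall>x. \<^bold>\<forall>y. (\<^bold>\<forall>z. z \<^bold>\<in> x \<^bold>\<longleftrightarrow> z \<^bold>\<in> y) \<^bold>\<longrightarrow> x \<^bold>= y) 0)"

definition Pairing :: fm where
  "Pairing = univ_closure ((\<^bold>\<forall>x. \<^bold>\<forall>y. \<^bold>\<exists>z. \<^bold>\<forall>w. w \<^bold>\<in> z \<^bold>\<longleftrightarrow> w \<^bold>= x \<^bold>\<or> w \<^bold>= y) 0)"

definition Union_ax :: fm where
  "Union_ax = univ_closure ((\<^bold>\<forall>x. \<^bold>\<exists>u. \<^bold>\<forall>z. z \<^bold>\<in> u \<^bold>\<longleftrightarrow> (\<^bold>\<exists>y. y \<^bold>\<in> x \<^bold>\<and> z \<^bold>\<in> y)) 0)"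

definition Power_set :: fm where
  "Power_set =
    univ_closure ((\<^bold>\<forall>x. \<^bold>\<exists>p. \<^bold>\<forall>y. y \<^bold>\<in> p \<^bold>\<longleftrightarrow> (\<^bold>\<forall>z. z \<^bold>\<in> y \<^bold>\<longrightarrow> z \<^bold>\<in> x)) 0)"

definition Infinity :: fm where
  "Infinity = univ_closure ((\<^bold>\<exists>w. is_inductive w) 0)"

definition Separation :: "fm \<Rightarrow> fm" where
  "Separation p = univ_closure ((\<^bold>\<forall>a. \<^bold>\<exists>b. \<^bold>\<forall>x. x \<^bold>\<in> b \<^bold>\<longleftrightarrow> x \<^bold>\<in> a \<^bold>\<and> app1 p x) 0)"

definition Replacement :: "fm \<Rightarrow> fm" where
  "Replacement p = univ_closure
    (((\<^bold>\<forall>x. \<^bold>\<forall>y. \<^bold>\<forall>z. app2 p x y \<^bold>\<and> app2 p x z \<^bold>\<longrightarrow> y \<^bold>= z) \<^bold>\<longrightarrow>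
      (\<^bold>\<forall>a. \<^bold>\<exists>b. \<^bold>\<forall>y. y \<^bold>\<in> b \<^bold>\<longleftrightarrow> (\<^bold>\<exists>x. x \<^bold>\<in> a \<^bold>\<and> app2 p x y))) 0)"

definition Foundation :: fm where
  "Foundation = univ_closure
    ((\<^bold>\<forall>x. (\<^bold>\<exists>y. y \<^bold>\<in> x) \<^bold>\<longrightarrow> (\<^bold>\<exists>y. y \<^bold>\<in> x \<^bold>\<and> \<^bold>\<not> (\<^bold>\<exists>z. z \<^bold>\<in> x \<^bold>\<and> z \<^bold>\<in> y))) 0)"

definition Choice :: fm where
  "Choice = univ_closure
    ((\<^bold>\<forall>a. (\<^bold>\<forall>x. x \<^bold>\<in> a \<^bold>\<longrightarrow> (\<^bold>\<exists>y. y \<^bold>\<in> x)) \<^bold>\<longrightarrow>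
       (\<^bold>\<exists>f. \<^bold>\<exists>b. is_fun f a b \<^bold>\<and> (\<^bold>\<forall>x. \<^bold>\<forall>y. \<langle>x, y\<rangle> \<^bold>\<in> f \<^bold>\<longrightarrow> y \<^bold>\<in> x))) 0)"

definition ZF0 :: "fm set" where
  "ZF0 = {Extensionality, Pairing, Union_ax, Power_set, Infinity}
    \<union> range Separation \<union> range Replacement"

definition ZFC0 :: "fm set" where
  "ZFC0 = ZF0 \<union> {Choice}"

definition ZF :: "fm set" where
  "ZF = ZF0 \<union> {Foundation}"

definition ZFC :: "fm set" where
  "ZFC = ZFC0 \<union> {Foundation}"


section \<open>Structures, satisfaction and elementary embeddings inside set theory\<close>

definition is_nat :: "trm \<Rightarrow> form" where
  "is_nat n = (\<^bold>\<forall>w. is_inductive w \<^bold>\<longrightarrow> n \<^bold>\<in> w)"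

definition tuple4 :: "trm \<Rightarrow> trm \<Rightarrow> trm \<Rightarrow> trm \<Rightarrow> trm" where
  "tuple4 m u r i = \<langle>m, \<langle>u, \<langle>r, i\<rangle>\<rangle>\<rangle>"

text \<open>\<open>is_structure a s\<close>: \<open>s\<close> is a structure for the language with constants indexed by \<open>a\<close>.\<close>

definition is_structure :: "trm \<Rightarrow> trm \<Rightarrow> form" where
  "is_structure a s = (\<^bold>\<exists>m. \<^bold>\<exists>u. \<^bold>\<exists>r. \<^bold>\<exists>i. s \<^bold>= tuple4 m u r i \<^bold>\<and>
     (\<^bold>\<forall>x. x \<^bold>\<in> u \<^bold>\<longrightarrow> x \<^bold>\<in> m) \<^bold>\<and>
     (\<^bold>\<forall>z. z \<^bold>\<in> r \<^bold>\<longrightarrow> (\<^bold>\<exists>x. \<^bold>\<exists>y. x \<^bold>\<in> m \<^bold>\<and> y \<^bold>\<in> m \<^bold>\<and> z \<^bold>= \<langle>x, y\<rangle>)) \<^bold>\<and>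
     is_fun i a m)"

text \<open>
  Syntax of the object language is coded by sets, with numerals as tags. \<open>is_formula a n p\<close> says
  that \<open>p\<close> codes a formula with constants indexed by \<open>a\<close> and free variables among
  \<open>v_0, \<dots>, v_(n-1)\<close>; a quantifier over a formula in \<open>v_0, \<dots>, v_n\<close> binds \<open>v_n\<close>. The formulas are
  the least set closed under the formation rules, so the codes are well-founded trees even where
  Foundation fails. Assignments for such formulas are functions with domain \<open>n\<close>, so sentences
  are evaluated correctly in the structure with empty universe, too.
\<close>

definition var_code :: "trm \<Rightarrow> trm" where "var_code i = \<langle>num 0, i\<rangle>"
definition const_code :: "trm \<Rightarrow> trm" where "const_code c = \<langle>num 1, c\<rangle>"

definition eq_code :: "trm \<Rightarrow> trm \<Rightarrow> trm" where "eq_code s t = \<langle>num 0, \<langle>s, t\<rangle>\<rangle>"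
definition U_code :: "trm \<Rightarrow> trm" where "U_code t = \<langle>num 1, t\<rangle>"
definition R_code :: "trm \<Rightarrow> trm \<Rightarrow> trm" where "R_code s t = \<langle>num 2, \<langle>s, t\<rangle>\<rangle>"
definition not_code :: "trm \<Rightarrow> trm" where "not_code p = \<langle>num 3, p\<rangle>"
definition and_code :: "trm \<Rightarrow> trm \<Rightarrow> trm" where "and_code p q = \<langle>num 4, \<langle>p, q\<rangle>\<rangle>"
definition ex_code :: "trm \<Rightarrow> trm" where "ex_code p = \<langle>num 5, p\<rangle>"

definition is_term :: "trm \<Rightarrow> trm \<Rightarrow> trm \<Rightarrow> form" where
  "is_term a n t =
    ((\<^bold>\<exists>i. i \<^bold>\<in> n \<^bold>\<and> t \<^bold>= var_code i) \<^bold>\<or> (\<^bold>\<exists>c. c \<^bold>\<in> a \<^bold>\<and> t \<^bold>= const_code c))"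

definition formation_closed :: "trm \<Rightarrow> trm \<Rightarrow> form" where
  "formation_closed a F = (\<^bold>\<forall>n. is_nat n \<^bold>\<longrightarrow>
     (\<^bold>\<forall>s. \<^bold>\<forall>t. is_term a n s \<^bold>\<and> is_term a n t \<^bold>\<longrightarrow> \<langle>n, eq_code s t\<rangle> \<^bold>\<in> F) \<^bold>\<and>
     (\<^bold>\<forall>t. is_term a n t \<^bold>\<longrightarrow> \<langle>n, U_code t\<rangle> \<^bold>\<in> F) \<^bold>\<and>
     (\<^bold>\<forall>s. \<^bold>\<forall>t. is_term a n s \<^bold>\<and> is_term a n t \<^bold>\<longrightarrow> \<langle>n, R_code s t\<rangle> \<^bold>\<in> F) \<^bold>\<and>
     (\<^bold>\<forall>p. \<langle>n, p\<rangle> \<^bold>\<in> F \<^bold>\<longrightarrow> \<langle>n, not_code p\<rangle> \<^bold>\<in> F) \<^bold>\<and>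
     (\<^bold>\<forall>p. \<^bold>\<forall>q. \<langle>n, p\<rangle> \<^bold>\<in> F \<^bold>\<and> \<langle>n, q\<rangle> \<^bold>\<in> F \<^bold>\<longrightarrow> \<langle>n, and_code p q\<rangle> \<^bold>\<in> F) \<^bold>\<and>
     (\<^bold>\<forall>p. \<langle>suc n, p\<rangle> \<^bold>\<in> F \<^bold>\<longrightarrow> \<langle>n, ex_code p\<rangle> \<^bold>\<in> F))"

definition is_formula :: "trm \<Rightarrow> trm \<Rightarrow> trm \<Rightarrow> form" where
  "is_formula a n p = (is_nat n \<^bold>\<and> (\<^bold>\<forall>F. formation_closed a F \<^bold>\<longrightarrow> \<langle>n, p\<rangle> \<^bold>\<in> F))"

text \<open>\<open>is_value i e t x\<close>: under the interpretation \<open>i\<close> of the constants and the assignment \<open>e\<close>,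
  the term coded by \<open>t\<close> has the value \<open>x\<close>.\<close>

definition is_value :: "trm \<Rightarrow> trm \<Rightarrow> trm \<Rightarrow> trm \<Rightarrow> form" where
  "is_value i e t x =
    ((\<^bold>\<exists>k. t \<^bold>= var_code k \<^bold>\<and> \<langle>k, x\<rangle> \<^bold>\<in> e) \<^bold>\<or> (\<^bold>\<exists>c. t \<^bold>= const_code c \<^bold>\<and> \<langle>c, x\<rangle> \<^bold>\<in> i))"

text \<open>\<open>is_sat_relation a m u r i S\<close>: \<open>S\<close> obeys Tarski's clauses for the structure
  \<open>\<langle>m, u, r, i\<rangle>\<close>.\<close>

definition is_sat_relation :: "trm \<Rightarrow> trm \<Rightarrow> trm \<Rightarrow> trm \<Rightarrow> trm \<Rightarrow> trm \<Rightarrow> form" where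
  "is_sat_relation a m u r i S = (\<^bold>\<forall>n. \<^bold>\<forall>e. is_nat n \<^bold>\<and> is_fun e n m \<^bold>\<longrightarrow>
     (\<^bold>\<forall>s. \<^bold>\<forall>t. is_term a n s \<^bold>\<and> is_term a n t \<^bold>\<longrightarrow>
        (\<langle>eq_code s t, e\<rangle> \<^bold>\<in> S \<^bold>\<longleftrightarrow> (\<^bold>\<exists>x. is_value i e s x \<^bold>\<and> is_value i e t x))) \<^bold>\<and>
     (\<^bold>\<forall>t. is_term a n t \<^bold>\<longrightarrow>
        (\<langle>U_code t, e\<rangle> \<^bold>\<in> S \<^bold>\<longleftrightarrow> (\<^bold>\<exists>x. is_value i e t x \<^bold>\<and> x \<^bold>\<in> u))) \<^bold>\<and>
     (\<^bold>\<forall>s. \<^bold>\<forall>t. is_term a n s \<^bold>\<and> is_term a n t \<^bold>\<longrightarrow>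
        (\<langle>R_code s t, e\<rangle> \<^bold>\<in> S \<^bold>\<longleftrightarrow>
          (\<^bold>\<exists>x. \<^bold>\<exists>y. is_value i e s x \<^bold>\<and> is_value i e t y \<^bold>\<and> \<langle>x, y\<rangle> \<^bold>\<in> r))) \<^bold>\<and>
     (\<^bold>\<forall>p. is_formula a n p \<^bold>\<longrightarrow>
        (\<langle>not_code p, e\<rangle> \<^bold>\<in> S \<^bold>\<longleftrightarrow> \<^bold>\<not> \<langle>p, e\<rangle> \<^bold>\<in> S)) \<^bold>\<and>
     (\<^bold>\<forall>p. \<^bold>\<forall>q. is_formula a n p \<^bold>\<and> is_formula a n q \<^bold>\<longrightarrow>
        (\<langle>and_code p q, e\<rangle> \<^bold>\<in> S \<^bold>\<longleftrightarrow> \<langle>p, e\<rangle> \<^bold>\<in> S \<^bold>\<and> \<langle>q, e\<rangle> \<^bold>\<in> S)) \<^bold>\<and>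
     (\<^bold>\<forall>p. is_formula a (suc n) p \<^bold>\<longrightarrow>
        (\<langle>ex_code p, e\<rangle> \<^bold>\<in> S \<^bold>\<longleftrightarrow>
          (\<^bold>\<exists>x. x \<^bold>\<in> m \<^bold>\<and> \<langle>p, adjoin e \<langle>n, x\<rangle>\<rangle> \<^bold>\<in> S))))"

definition satisfies :: "trm \<Rightarrow> trm \<Rightarrow> trm \<Rightarrow> trm \<Rightarrow> trm \<Rightarrow> trm \<Rightarrow> trm \<Rightarrow> form" where
  "satisfies a m u r i p e = (\<^bold>\<exists>S. is_sat_relation a m u r i S \<^bold>\<and> \<langle>p, e\<rangle> \<^bold>\<in> S)"

text \<open>\<open>fun_comp f e\<close> is the function \<open>f \<circ> e\<close>.\<close>

definition fun_comp :: "trm \<Rightarrow> trm \<Rightarrow> trm" where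
  "fun_comp f e =
    coll (\<lambda>w. \<^bold>\<exists>k. \<^bold>\<exists>x. \<^bold>\<exists>y. \<langle>k, x\<rangle> \<^bold>\<in> e \<^bold>\<and> \<langle>x, y\<rangle> \<^bold>\<in> f \<^bold>\<and> w \<^bold>= \<langle>k, y\<rangle>)"

definition is_elementary_embedding :: "trm \<Rightarrow> trm \<Rightarrow> trm \<Rightarrow> trm \<Rightarrow> form" where
  "is_elementary_embedding a f M N =
    (\<^bold>\<exists>m. \<^bold>\<exists>u. \<^bold>\<exists>r. \<^bold>\<exists>i. \<^bold>\<exists>m'. \<^bold>\<exists>u'. \<^bold>\<exists>r'. \<^bold>\<exists>i'.
       M \<^bold>= tuple4 m u r i \<^bold>\<and> N \<^bold>= tuple4 m' u' r' i' \<^bold>\<and> is_fun f m m' \<^bold>\<and>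
       (\<^bold>\<forall>n. \<^bold>\<forall>p. \<^bold>\<forall>e. is_formula a n p \<^bold>\<and> is_fun e n m \<^bold>\<longrightarrow>
          (satisfies a m u r i p e \<^bold>\<longleftrightarrow> satisfies a m' u' r' i' p (fun_comp f e))))"


section \<open>Vopenka's Principle\<close>

text \<open>As in the other schemes, the formula \<open>p\<close> defining the class may contain parameters.\<close>

definition is_proper_class :: "fm \<Rightarrow> form" where
  "is_proper_class p =
    (\<^bold>\<forall>x. \<^bold>\<exists>y. (app1 p y \<^bold>\<and> \<^bold>\<not> y \<^bold>\<in> x) \<^bold>\<or> (\<^bold>\<not> app1 p y \<^bold>\<and> y \<^bold>\<in> x))"

definition Vopenka :: "fm \<Rightarrow> fm" where
  "Vopenka p = univ_closure
    ((\<^bold>\<forall>a. is_proper_class p \<^bold>\<and> (\<^bold>\<forall>x. app1 p x \<^bold>\<longrightarrow> is_structure a x) \<^bold>\<longrightarrow>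
       (\<^bold>\<exists>M. \<^bold>\<exists>N. app1 p M \<^bold>\<and> app1 p N \<^bold>\<and> \<^bold>\<not> M \<^bold>= N \<^bold>\<and>
          (\<^bold>\<exists>f. is_elementary_embedding a f M N))) 0)"

definition VP :: "fm set" where
  "VP = range Vopenka"

end

theory Submission
  imports Defs "HOL-Library.Countable" "HOL-Library.Infinite_Set"
begin

text \<open>By the completeness theorem it suffices to turn a model \<open>E\<close> of \<open>ZF + VP\<close> into a model of
  \<open>ZF\<^sub>0 + VP + \<not> Foundation\<close>. This is the permutation model \<open>x \<in>' y \<longleftrightarrow> x \<in> \<pi> y\<close>, where \<open>\<pi>\<close> swaps
  \<open>p = {1, 2, 3}\<close> and \<open>q = {1, 2, p}\<close>. Since \<open>p \<in> q = \<pi> p\<close>, the set \<open>{p}\<close> violates Foundation. The axioms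
  of \<open>ZF\<^sub>0\<close> and Choice hold as in every permutation model. The points \<open>p\<close> and \<open>q\<close> are neither
  pairs nor natural numbers nor relations, so \<open>E\<close> and \<open>\<in>'\<close> have literally the same ordered
  pairs, natural numbers, codes of formulas and assignments. Therefore a structure
  \<open>\<langle>m, u, r, i\<rangle>\<close> of the new model satisfies the same formulas as the structure
  \<open>\<langle>\<pi> m, \<pi> u, \<pi> r, \<pi> i\<rangle>\<close> of \<open>E\<close>, and an instance of VP for \<open>\<in>'\<close> follows from the instance of
  VP for the class of the structures so translated.\<close>

section \<open>Soundness and completeness\<close>

text \<open>The obstacle is that VP speaks of satisfaction through coded syntax. The usual swap of 0
  and {0} would move numerals and pairs, so the codes of the two models would be merely isomorphic
  and would have to be compared by recursion inside set theory. Here the moved points have no shape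
  that the coding of syntax relies on, and the comparison becomes rewriting: a set \<open>y\<close>
  of the new model is read in \<open>E\<close> as \<open>\<pi> y\<close>, and most coding notions do
  not change at all. A structure is a tuple, hence the same set in both models, but its components
  are read through \<open>\<pi>\<close>; this is why the class in VP has to be translated. Both
  points can be named by parameters, so every formula about the new membership is a formula about
  the old one, and the schemes, which admit parameters, absorb the translation. Completeness yields
  a model on a set of naturals; moving it to the whole type \<open>nat\<close> lets the semantic
  notions quantify over a type.\<close>

lemma ren_cong: "(\<And>i. i < fv_bound p \<Longrightarrow> r i = r' i) \<Longrightarrow> ren r p = ren r' p"
proof (induction p arbitrary: r r')
  case (All p)
  have "ren (case_nat 0 (\<lambda>i. Suc (r i))) p = ren (case_nat 0 (\<lambda>i. Suc (r' i))) p"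
    using All.prems by (intro All.IH) (auto split: nat.split)
  then show ?case by simp
next
  case (Imp p q)
  have "ren r p = ren r' p" "ren r q = ren r' q"
    using Imp.prems by (auto intro!: Imp.IH)
  then show ?case by simp
qed auto

lemma ren_ren: "ren r (ren s p) = ren (\<lambda>i. r (s i)) p"
proof (induction p arbitrary: r s)
  case (All p)
  have "(\<lambda>i. case_nat 0 (\<lambda>i. Suc (r i)) (case_nat 0 (\<lambda>i. Suc (s i)) i)) = case_nat 0 (\<lambda>i. Suc (r (s i)))"
    by (auto split: nat.split)
  then show ?case by (simp add: All)
qed auto

lemma ren_id: "ren (\<lambda>i. i) p = p"
proof (induction p)
  case (All p)
  have "case_nat 0 (\<lambda>i. Suc i) = (\<lambda>i. i)" by (auto split: nat.split)
  then show ?case using All by simp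
qed auto

lemma ren_sentence: "fv_bound p = 0 \<Longrightarrow> ren r p = p"
  using ren_cong[of p r "\<lambda>i. i"] by (simp add: ren_id)

lemma inst_ren_lift: "inst i (ren (case_nat 0 (\<lambda>j. Suc (r j))) p) = ren (case_nat i r) p"
  by (auto simp: inst_def ren_ren split: nat.split intro!: ren_cong)

lemma ren_inst: "ren r (inst i p) = inst (r i) (ren (case_nat 0 (\<lambda>j. Suc (r j))) p)"
  unfolding inst_ren_lift by (auto simp: inst_def ren_ren split: nat.split intro!: ren_cong)

lemma ren_lift_Suc: "ren (case_nat 0 (\<lambda>j. Suc (r j))) (ren Suc p) = ren Suc (ren r p)"
  by (simp add: ren_ren)

lemma fv_bound_univ_closure: "fv_bound (univ_closure p) = 0"
proof -
  have "fv_bound ((All ^^ n) p) = fv_bound p - n" for n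
    by (induction n) auto
  then show ?thesis by (simp add: univ_closure_def)
qed

section \<open>Satisfaction and soundness\<close>

primrec sat :: "'a set \<Rightarrow> ('a \<Rightarrow> 'a \<Rightarrow> bool) \<Rightarrow> (nat \<Rightarrow> 'a) \<Rightarrow> fm \<Rightarrow> bool" where
  "sat D E \<rho> (Eq i j) \<longleftrightarrow> \<rho> i = \<rho> j"
| "sat D E \<rho> (Mem i j) \<longleftrightarrow> E (\<rho> i) (\<rho> j)"
| "sat D E \<rho> Fls \<longleftrightarrow> False"
| "sat D E \<rho> (Imp p q) \<longleftrightarrow> (sat D E \<rho> p \<longrightarrow> sat D E \<rho> q)"
| "sat D E \<rho> (All p) \<longleftrightarrow> (\<forall>x\<in>D. sat D E (case_nat x \<rho>) p)"

lemma sat_ren: "sat D E \<rho> (ren r p) \<longleftrightarrow> sat D E (\<lambda>i. \<rho> (r i)) p"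
proof (induction p arbitrary: r \<rho>)
  case (All p)
  have "(\<lambda>i. case_nat x \<rho> (case_nat 0 (\<lambda>i. Suc (r i)) i)) = case_nat x (\<lambda>i. \<rho> (r i))" for x
    by (auto split: nat.split)
  then show ?case by (simp add: All)
qed auto

lemma sat_inst: "sat D E \<rho> (inst i p) \<longleftrightarrow> sat D E (case_nat (\<rho> i) \<rho>) p"
proof -
  have "(\<lambda>j. \<rho> (case_nat i (\<lambda>j. j) j)) = case_nat (\<rho> i) \<rho>"
    by (auto split: nat.split)
  then show ?thesis by (simp add: inst_def sat_ren)
qed

lemma soundness:
  assumes "proves T p" and "\<And>p \<rho>. p \<in> T \<Longrightarrow> sat UNIV E \<rho> p"
  shows "sat UNIV E \<rho> p"
  using assms(1)
proof (induction arbitrary: \<rho>)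
  case (Ax p)
  then show ?case by (rule assms(2))
qed (auto simp: sat_inst sat_ren)

lemma sat_univ_closure: "(\<forall>\<rho>. sat UNIV E \<rho> (univ_closure p)) \<longleftrightarrow> (\<forall>\<rho>. sat UNIV E \<rho> p)"
proof -
  have *: "(\<forall>\<rho>. sat UNIV E \<rho> (All p)) \<longleftrightarrow> (\<forall>\<rho>. sat UNIV E \<rho> p)" for p
  proof
    assume A: "\<forall>\<rho>. sat UNIV E \<rho> (All p)"
    show "\<forall>\<rho>. sat UNIV E \<rho> p"
    proof
      fix \<rho> :: "nat \<Rightarrow> 'a"
      have "case_nat (\<rho> 0) (\<lambda>i. \<rho> (Suc i)) = \<rho>" by (auto split: nat.split)
      moreover have "sat UNIV E (case_nat (\<rho> 0) (\<lambda>i. \<rho> (Suc i))) p" using A by auto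
      ultimately show "sat UNIV E \<rho> p" by simp
    qed
  qed auto
  have "(\<forall>\<rho>. sat UNIV E \<rho> ((All ^^ n) p)) \<longleftrightarrow> (\<forall>\<rho>. sat UNIV E \<rho> p)" for n
  proof (induction n)
    case (Suc n)
    then show ?case using *[of "(All ^^ n) p"] by simp
  qed simp
  then show ?thesis by (simp add: univ_closure_def)
qed

section \<open>Renaming of derivations and the deduction theorem\<close>

lemma proves_ren:
  assumes "proves T p" and "\<And>p. p \<in> T \<Longrightarrow> fv_bound p = 0"
  shows "proves T (ren r p)"
  using assms(1)
proof (induction arbitrary: r)
  case (Ax p)
  then show ?case using assms(2) by (simp add: ren_sentence proves.Ax)
next
  case (All_inst p i)
  show ?case by (simp add: ren_inst proves.All_inst)
next
  case (All_vac p)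
  show ?case by (simp add: ren_lift_Suc proves.All_vac)
next
  case (Eq_subst i j p)
  show ?case by (simp add: ren_inst proves.Eq_subst)
next
  case (MP p q)
  from MP.IH(1)[of r] MP.IH(2)[of r] show ?case by (auto intro: proves.MP)
qed (auto intro: proves.intros)

text \<open>In a derivation from hypotheses the rule \<open>Gen\<close> is available for theorems of \<open>T\<close> only, so the
  free variables of the hypotheses act as constants.\<close>

inductive ded :: "fm set \<Rightarrow> fm set \<Rightarrow> fm \<Rightarrow> bool" for T G where
  hyp: "p \<in> G \<Longrightarrow> ded T G p"
| ax: "proves T p \<Longrightarrow> ded T G p"
| mp: "ded T G (Imp p q) \<Longrightarrow> ded T G p \<Longrightarrow> ded T G q"

lemma ded_mono: "ded T G p \<Longrightarrow> G \<subseteq> G' \<Longrightarrow> ded T G' p"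
  by (induction rule: ded.induct) (auto intro: ded.intros)

lemma ded_empty: "ded T {} p \<Longrightarrow> proves T p"
  by (induction rule: ded.induct) (auto intro: proves.MP)

lemma ded_K: "ded T G q \<Longrightarrow> ded T G (Imp p q)"
  by (meson ded.mp ded.ax proves.K)

lemma proves_Imp_self: "proves T (Imp p p)"
  by (meson proves.K proves.S proves.MP)

lemma deduction: "ded T (insert p G) q \<Longrightarrow> ded T G (Imp p q)"
proof (induction rule: ded.induct)
  case (hyp q)
  then show ?case by (auto intro: ded.ax proves_Imp_self ded_K ded.hyp)
next
  case (ax q)
  then show ?case by (auto intro: ded.ax ded_K)
next
  case (mp q r)
  then show ?case by (meson ded.mp ded.ax proves.S)
qed

lemma ded_by_contradiction: "ded T (insert (Imp p Fls) G) Fls \<Longrightarrow> ded T G p"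
  by (meson deduction ded.mp ded.ax proves.DN)

lemma ded_ex_falso: "ded T G Fls \<Longrightarrow> ded T G p"
  by (meson ded_by_contradiction ded_mono subset_insertI)

lemma ded_ren:
  assumes "ded T G p" and "\<And>p. p \<in> T \<Longrightarrow> fv_bound p = 0"
  shows "ded T (ren r ` G) (ren r p)"
  using assms(1)
proof (induction rule: ded.induct)
  case (mp p q)
  then show ?case by (auto intro: ded.mp)
qed (auto intro: ded.hyp ded.ax proves_ren assms(2))

text \<open>This is \<open>Gen\<close> under hypotheses whose indices are shifted past the new
  quantifier: a shifted hypothesis is generalised by \<open>All_vac\<close>, a theorem of
  \<open>T\<close> by \<open>Gen\<close>, and \<open>All_Imp\<close> carries modus ponens under the
  quantifier.\<close>

lemma ded_All: "ded T (ren Suc ` G) p \<Longrightarrow> ded T G (All p)"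
proof (induction rule: ded.induct)
  case (hyp p)
  then show ?case by (auto intro: ded.mp ded.ax proves.All_vac ded.hyp)
next
  case (ax p)
  then show ?case by (auto intro: ded.ax proves.Gen)
next
  case (mp p q)
  then show ?case by (meson ded.mp ded.ax proves.All_Imp)
qed

lemma ded_generalise_fresh:
  assumes "ded T G (inst i p)" and T: "\<And>p. p \<in> T \<Longrightarrow> fv_bound p = 0"
    and fresh: "\<And>g. g \<in> G \<Longrightarrow> fv_bound g \<le> i" "fv_bound p \<le> i"
  shows "ded T G (All p)"
proof -
  \<comment> \<open>\<open>r\<close> sends the fresh index to the quantified variable 0 and shifts
    the rest. On \<open>G\<close>, where \<open>i\<close> is not free, it acts as
    \<open>Suc\<close>; on \<open>inst i p\<close> it undoes the instantiation, since the bound on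
    \<open>p\<close> keeps its other indices away from \<open>i\<close>.\<close>
  define r where "r j = (if j = i then 0 else Suc j)" for j
  have "ren r ` G = ren Suc ` G"
    using fresh(1) by (intro image_cong refl ren_cong) (fastforce simp: r_def)
  moreover have "ren r (inst i p) = ren (\<lambda>j. j) p"
    unfolding inst_def ren_ren using fresh(2)
    by (intro ren_cong) (auto simp: r_def split: nat.split)
  ultimately have "ded T (ren Suc ` G) p"
    using ded_ren[OF assms(1) T, of r] by (simp add: ren_id)
  then show ?thesis by (rule ded_All)
qed

text \<open>A refutation of the Henkin axiom yields both \<open>inst i p\<close> and \<open>\<not> All p\<close>, but \<open>i\<close> is fresh.\<close>

lemma consistent_insert_Henkin_axiom:
  assumes "\<not> ded T G Fls" and "\<And>p. p \<in> T \<Longrightarrow> fv_bound p = 0"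
    and "\<And>g. g \<in> G \<Longrightarrow> fv_bound g \<le> i" "fv_bound p \<le> i"
  shows "\<not> ded T (insert (Imp (inst i p) (All p)) G) Fls"
proof
  assume "ded T (insert (Imp (inst i p) (All p)) G) Fls"
  then have neg: "ded T G (Imp (Imp (inst i p) (All p)) Fls)" by (rule deduction)
  have "ded T (insert (Imp (inst i p) Fls) G) (Imp (inst i p) (All p))"
    by (rule deduction, rule ded_ex_falso) (auto intro: ded.mp ded.hyp)
  then have "ded T (insert (Imp (inst i p) Fls) G) Fls"
    using ded_mono[OF neg subset_insertI] ded.mp by blast
  then have "ded T G (inst i p)" by (rule ded_by_contradiction)
  then have "ded T G (All p)" by (rule ded_generalise_fresh) (use assms in auto)
  then show False using neg assms(1) by (meson ded.mp ded_K)
qed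

section \<open>Henkin's completeness proof\<close>

instance fm :: countable by countable_datatype

text \<open>Stage n decides the n-th formula and adds its Henkin axiom. Every stage is finite, so
  some index is always fresh; thus variables serve as Henkin constants and the language stays the
  same.\<close>

lemma Henkin_extension:
  assumes "consistent T" and T: "\<And>p. p \<in> T \<Longrightarrow> fv_bound p = 0"
  obtains H where "\<And>p. proves T p \<Longrightarrow> p \<in> H" "\<And>p q. Imp p q \<in> H \<Longrightarrow> p \<in> H \<Longrightarrow> q \<in> H"
    "Fls \<notin> H" "\<And>p. p \<in> H \<or> Imp p Fls \<in> H" "\<And>p. \<exists>i. Imp (inst i p) (All p) \<in> H"
proof -
  define ok where "ok G \<longleftrightarrow> finite G \<and> \<not> ded T G Fls" for G
  define good where "good p G G' \<longleftrightarrow> ok G' \<and> G \<subseteq> G' \<and> (p \<in> G' \<or> ded T G' (Imp p Fls)) \<and>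
      (\<exists>i. Imp (inst i p) (All p) \<in> G')" for p G G'
  have step: "\<exists>G'. good p G G'" if "ok G" for p G
  proof -
    \<comment> \<open>If adding \<open>p\<close> is inconsistent, the deduction theorem already
      yields its negation from \<open>G\<close>.\<close>
    define G1 where "G1 = (if ded T (insert p G) Fls then G else insert p G)"
    have G1: "ok G1" "G \<subseteq> G1" "p \<in> G1 \<or> ded T G1 (Imp p Fls)"
      using that deduction[of T p G Fls] by (simp_all add: G1_def ok_def subset_insertI)
    define i where "i = Max (fv_bound ` insert p G1)"
    have "fv_bound g \<le> i" if "g \<in> insert p G1" for g
      using G1(1) that unfolding i_def ok_def by (intro Max_ge) auto
    then have "\<not> ded T (insert (Imp (inst i p) (All p)) G1) Fls"
      using G1(1) by (intro consistent_insert_Henkin_axiom T) (auto simp: ok_def)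
    then have "good p G (insert (Imp (inst i p) (All p)) G1)"
      using G1 unfolding ok_def good_def by (blast intro: ded_mono)
    then show ?thesis by blast
  qed
  \<comment> \<open>\<open>SOME\<close> is known to give a good extension only of an
    \<open>ok\<close> stage, so \<open>good\<close> is first conditional and \<open>ok\<close> then
    follows by induction.\<close>
  define G where "G = rec_nat {} (\<lambda>n G. SOME G'. good (from_nat n) G G')"
  have G_Suc: "G (Suc n) = (SOME G'. good (from_nat n) (G n) G')" for n
    by (simp add: G_def)
  have good: "good (from_nat n) (G n) (G (Suc n))" if "ok (G n)" for n
    unfolding G_Suc using step[OF that] by (rule someI_ex)
  have ok: "ok (G n)" for n
  proof (induction n)
    case 0
    show ?case using assms(1) by (auto simp: G_def ok_def consistent_def dest: ded_empty)
  next
    case (Suc n)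
    then show ?case using good by (simp add: good_def)
  qed
  have mono: "G m \<subseteq> G n" if "m \<le> n" for m n
  proof -
    have "G n \<subseteq> G (Suc n)" for n using good[OF ok] unfolding good_def by blast
    then show ?thesis using that by (rule lift_Suc_mono_le)
  qed
  define H where "H = {p. \<exists>n. ded T (G n) p}"
  show thesis
  proof
    show "p \<in> H" if "proves T p" for p using that by (auto simp: H_def intro: ded.ax)
    show "q \<in> H" if pq: "Imp p q \<in> H" "p \<in> H" for p q
    proof -
      obtain m n where mn: "ded T (G m) (Imp p q)" "ded T (G n) p" using pq by (auto simp: H_def)
      have "ded T (G (max m n)) (Imp p q)" "ded T (G (max m n)) p"
        using mn mono[of m "max m n"] mono[of n "max m n"] by (auto intro: ded_mono)
      then show ?thesis by (auto simp: H_def intro: ded.mp)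
    qed
    show "Fls \<notin> H" using ok by (auto simp: H_def ok_def)
    fix p
    have g: "good p (G (to_nat p)) (G (Suc (to_nat p)))" using good[OF ok, of "to_nat p"] by simp
    then show "p \<in> H \<or> Imp p Fls \<in> H" by (auto simp: H_def good_def intro: ded.hyp)
    show "\<exists>i. Imp (inst i p) (All p) \<in> H"
      using g unfolding H_def good_def by (blast intro: ded.hyp)
  qed
qed

text \<open>The model consists of the variables, identified when \<open>H\<close> contains their
  equation. Maximality and deductive closure of \<open>H\<close> decide the connectives, and the
  Henkin axioms reduce \<open>All p\<close> to its instances.\<close>

theorem completeness:
  assumes "consistent T" and T: "\<And>p. p \<in> T \<Longrightarrow> fv_bound p = 0"
  obtains D :: "nat set" and E where "D \<noteq> {}" "\<And>p \<rho>. p \<in> T \<Longrightarrow> (\<And>i. \<rho> i \<in> D) \<Longrightarrow> sat D E \<rho> p"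
proof -
  obtain H where ax: "\<And>p. proves T p \<Longrightarrow> p \<in> H" and mp: "\<And>p q. Imp p q \<in> H \<Longrightarrow> p \<in> H \<Longrightarrow> q \<in> H"
    and Fls: "Fls \<notin> H" and max: "\<And>p. p \<in> H \<or> Imp p Fls \<in> H"
    and wit: "\<And>p. \<exists>i. Imp (inst i p) (All p) \<in> H"
    by (rule Henkin_extension[OF assms]) blast+
  have subst: "inst j p \<in> H" if "Eq i j \<in> H" "inst i p \<in> H" for i j p
    using that mp ax proves.Eq_subst by blast
  have refl: "Eq i i \<in> H" for i using ax proves.Eq_refl by blast
  \<comment> \<open>Under \<open>inst\<close>, index 0 is the hole and the side variable is shifted
    by \<open>Suc\<close>; the next facts vary only the atom.\<close>
  have sym: "Eq j i \<in> H" if "Eq i j \<in> H" for i j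
    using subst[OF that, of "Eq 0 (Suc i)"] refl by (simp add: inst_def)
  have trans: "Eq i k \<in> H" if "Eq i j \<in> H" "Eq j k \<in> H" for i j k
    using subst[OF that(2), of "Eq (Suc i) 0"] that(1) by (simp add: inst_def)
  have Mem1: "Mem i' j \<in> H" if "Eq i i' \<in> H" "Mem i j \<in> H" for i i' j
    using subst[OF that(1), of "Mem 0 (Suc j)"] that(2) by (simp add: inst_def)
  have Mem2: "Mem i j' \<in> H" if "Eq j j' \<in> H" "Mem i j \<in> H" for i j j'
    using subst[OF that(1), of "Mem (Suc i) 0"] that(2) by (simp add: inst_def)
  \<comment> \<open>Least representatives replace equivalence classes, which keeps the domain a set
    of naturals.\<close>
  define c where "c i = (LEAST j. Eq i j \<in> H)" for i
  have c: "Eq i (c i) \<in> H" for i unfolding c_def using refl by (rule LeastI)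
  have c_eq: "c i = c j \<longleftrightarrow> Eq i j \<in> H" for i j
  proof
    assume "c i = c j"
    then show "Eq i j \<in> H" using c[of i] c[of j] by (metis sym trans)
  next
    assume "Eq i j \<in> H"
    then have "Eq i k \<in> H \<longleftrightarrow> Eq j k \<in> H" for k by (metis sym trans)
    then show "c i = c j" by (simp add: c_def)
  qed
  define E where "E x y \<longleftrightarrow> Mem x y \<in> H" for x y
  have E: "E (c i) (c j) \<longleftrightarrow> Mem i j \<in> H" for i j
    unfolding E_def by (meson c Mem1 Mem2 sym)
  have Imp: "Imp p q \<in> H \<longleftrightarrow> (p \<in> H \<longrightarrow> q \<in> H)" for p q
  proof (cases "p \<in> H")
    case True
    then show ?thesis using mp ax proves.K by blast
  next
    case False
    then have "ded T H (Imp p Fls)" using max by (auto intro: ded.hyp)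
    then have "ded T H (Imp p q)"
      by (meson deduction ded_ex_falso ded.mp ded.hyp ded_mono insertI1 subset_insertI)
    moreover have "r \<in> H" if "ded T H r" for r
      using that by (induction rule: ded.induct) (auto intro: ax mp)
    ultimately show ?thesis using False by blast
  qed
  have All: "All p \<in> H \<longleftrightarrow> (\<forall>i. inst i p \<in> H)" for p
    using wit[of p] mp ax proves.All_inst by blast
  have truth: "sat (range c) E (\<lambda>i. c (\<rho> i)) p \<longleftrightarrow> ren \<rho> p \<in> H" for p \<rho>
  proof (induction p arbitrary: \<rho>)
    case (All p)
    have "case_nat (c j) (\<lambda>i. c (\<rho> i)) = (\<lambda>i. c (case_nat j \<rho> i))" for j
      by (auto split: nat.split)
    then show ?case by (simp add: All.IH \<open>\<And>p. _ \<longleftrightarrow> (\<forall>i. inst i p \<in> H)\<close> inst_ren_lift)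
  qed (auto simp: c_eq E Imp Fls)
  show thesis
  proof
    show "range c \<noteq> {}" by simp
    fix p and \<rho> :: "nat \<Rightarrow> nat"
    assume p: "p \<in> T" and "\<And>i. \<rho> i \<in> range c"
    then have "\<forall>i. \<exists>j. \<rho> i = c j" by blast
    then obtain \<sigma> where \<sigma>: "\<And>i. \<rho> i = c (\<sigma> i)" by metis
    have "ren \<sigma> p \<in> H" using p T by (simp add: ren_sentence ax proves.Ax)
    then show "sat (range c) E \<rho> p" using truth[of \<sigma> p] \<sigma> by presburger
  qed
qed

section \<open>Models whose domain is a whole type\<close>

lemma sat_transfer_bij:
  assumes "bij_betw h UNIV D"
  shows "sat UNIV (\<lambda>x y. E (h x) (h y)) \<rho> p \<longleftrightarrow> sat D E (\<lambda>i. h (\<rho> i)) p"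
proof (induction p arbitrary: \<rho>)
  case (Eq i j)
  then show ?case using assms by (auto simp: bij_betw_def inj_eq)
next
  case (All p)
  have "case_nat (h x) (\<lambda>i. h (\<rho> i)) = (\<lambda>i. h (case_nat x \<rho> i))" for x
    by (auto split: nat.split)
  moreover have "D = range h" using assms by (simp add: bij_betw_def)
  ultimately show ?case by (simp add: All)
qed auto

lemmas form_defs = fFls_def fImp_def fAll_def fNot_def fAnd_def fOr_def fIff_def fEx_def fEq_def fMem_def
  app1_def app_def

text \<open>The map \<open>x \<mapsto> {x}\<close> is injective and misses the empty set.\<close>

lemma infinite_model_of_set_theory:
  assumes "D \<noteq> {}" and T: "\<And>p \<rho>. p \<in> ZF0 \<Longrightarrow> (\<And>i. \<rho> i \<in> D) \<Longrightarrow> sat D E \<rho> p"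
  shows "infinite D"
proof
  assume fin: "finite D"
  obtain d where d: "d \<in> D" using assms(1) by blast
  have "sat D E (\<lambda>_. d) Pairing" "sat D E (\<lambda>_. d) (Separation Fls)"
    using d by (auto intro!: T simp: ZF0_def)
  then have *: "\<forall>x\<in>D. \<forall>y\<in>D. \<exists>z\<in>D. \<forall>w\<in>D. (E w z \<longrightarrow> w = x \<or> w = y) \<and> (w \<noteq> x \<and> w \<noteq> y \<or> E w z)"
    and empty: "\<exists>z\<in>D. \<forall>w\<in>D. \<not> E w z"
    using d by (auto simp: Pairing_def Separation_def univ_closure_def form_defs)
  have pair: "\<exists>z\<in>D. \<forall>w\<in>D. E w z \<longleftrightarrow> w = x" if "x \<in> D" for x
    using *[rule_format, OF that that] by blast
  from pair obtain s where s: "\<And>x. x \<in> D \<Longrightarrow> s x \<in> D" "\<And>x w. x \<in> D \<Longrightarrow> w \<in> D \<Longrightarrow> E w (s x) \<longleftrightarrow> w = x"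
    by metis
  have "inj_on s D" by (rule inj_onI) (metis s)
  then have "s ` D = D" using fin s(1) by (intro endo_inj_surj) auto
  then show False using empty s by (metis imageE)
qed

text \<open>The increasing enumeration of an infinite domain is a bijection from \<open>nat\<close>,
  and truth is invariant under pulling \<open>E\<close> back along it.\<close>

corollary model_of_consistent_set_theory:
  assumes "consistent T" "\<And>p. p \<in> T \<Longrightarrow> fv_bound p = 0" "ZF0 \<subseteq> T"
  shows "\<exists>E :: nat \<Rightarrow> nat \<Rightarrow> bool. \<forall>p\<in>T. \<forall>\<rho>. sat UNIV E \<rho> p"
proof -
  obtain D :: "nat set" and E where D: "D \<noteq> {}" "\<And>p \<rho>. p \<in> T \<Longrightarrow> (\<And>i. \<rho> i \<in> D) \<Longrightarrow> sat D E \<rho> p"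
    by (rule completeness[OF assms(1,2)]) blast+
  have "infinite D" using D assms(3) by (intro infinite_model_of_set_theory) auto
  then have bij: "bij_betw (enumerate D) UNIV D"
    by (rule bij_enumerate)
  have "sat UNIV (\<lambda>x y. E (enumerate D x) (enumerate D y)) \<rho> p" if "p \<in> T" for p \<rho>
    unfolding sat_transfer_bij[OF bij] using that bij by (intro D(2)) (auto simp: bij_betw_def)
  then show ?thesis by blast
qed

section \<open>The meaning of forms\<close>

text \<open>A context consists of a depth and a valuation of the levels below it. \<open>means\<close> and \<open>denotes\<close> quantify over
  all larger contexts because \<open>elim_desc\<close> and the binders move forms and terms to larger depths.\<close>

type_synonym 'a ctx = "nat \<times> (nat \<Rightarrow> 'a)"

definition env :: "(nat \<Rightarrow> 'a) \<Rightarrow> 'a ctx \<Rightarrow> nat \<Rightarrow> 'a" where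
  "env par c i = (if i < fst c then snd c (fst c - Suc i) else par (i - fst c))"

definition extends :: "'a ctx \<Rightarrow> 'a ctx \<Rightarrow> bool" (infix "\<preceq>" 50) where
  "c \<preceq> c' \<longleftrightarrow> fst c \<le> fst c' \<and> (\<forall>l<fst c. snd c' l = snd c l)"

definition means :: "('a \<Rightarrow> 'a \<Rightarrow> bool) \<Rightarrow> (nat \<Rightarrow> 'a) \<Rightarrow> 'a ctx \<Rightarrow> form \<Rightarrow> bool \<Rightarrow> bool" where
  "means E par c P B \<longleftrightarrow> (\<forall>c'. c \<preceq> c' \<longrightarrow> (sat UNIV E (env par c') (P (fst c')) \<longleftrightarrow> B))"

definition denotes :: "('a \<Rightarrow> 'a \<Rightarrow> bool) \<Rightarrow> (nat \<Rightarrow> 'a) \<Rightarrow> 'a ctx \<Rightarrow> trm \<Rightarrow> 'a \<Rightarrow> bool" where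
  "denotes E par c t x = (case t of
     Var l \<Rightarrow> l < fst c \<and> snd c l = x
   | Desc Q \<Rightarrow> (\<forall>c' k. c \<preceq> c' \<and> k < fst c' \<longrightarrow> means E par c' (Q k) (snd c' k = x)))"

lemma extends_refl: "c \<preceq> c"
  by (simp add: extends_def)

lemma extends_trans: "c \<preceq> c' \<Longrightarrow> c' \<preceq> c'' \<Longrightarrow> c \<preceq> c''"
  unfolding extends_def by (metis order_trans order_less_le_trans)

lemma extends_push: "c \<preceq> (Suc (fst c), (snd c)(fst c := x))"
  by (simp add: extends_def)

lemma env_push: "env par (Suc (fst c), (snd c)(fst c := x)) = case_nat x (env par c)"
proof
  fix i
  show "env par (Suc (fst c), (snd c)(fst c := x)) i = case_nat x (env par c) i"
    by (cases i) (auto simp: env_def)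
qed

lemma env_Nil: "env par (0, v) = par"
  by (simp add: env_def fun_eq_iff)

lemma denotes_mono: "c \<preceq> c' \<Longrightarrow> denotes E par c t x \<Longrightarrow> denotes E par c' t x"
proof (cases t)
  case (Desc Q)
  then show "c \<preceq> c' \<Longrightarrow> denotes E par c t x \<Longrightarrow> denotes E par c' t x"
    using extends_trans[of c c'] by (simp add: denotes_def)
qed (auto simp: denotes_def extends_def)

lemma denotes_push: "denotes E par (Suc (fst c), (snd c)(fst c := x)) (Var (fst c)) x"
  by (simp add: denotes_def)

lemma means_sat: "means E par c P B \<Longrightarrow> sat UNIV E (env par c) (P (fst c)) \<longleftrightarrow> B"
  unfolding means_def using extends_refl[of c] by blast

lemma means_Fls: "means E par c \<^bold>\<bottom> False"
  by (simp add: means_def fFls_def)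

lemma means_Imp: "means E par c P A \<Longrightarrow> means E par c Q B \<Longrightarrow> means E par c (P \<^bold>\<longrightarrow> Q) (A \<longrightarrow> B)"
  by (simp add: means_def fImp_def)

lemma means_Not: "means E par c P A \<Longrightarrow> means E par c (\<^bold>\<not> P) (\<not> A)"
  by (simp add: means_def fImp_def fNot_def fFls_def)

lemma means_And: "means E par c P A \<Longrightarrow> means E par c Q B \<Longrightarrow> means E par c (P \<^bold>\<and> Q) (A \<and> B)"
  by (simp add: means_def fImp_def fNot_def fAnd_def fFls_def)

lemma means_Or: "means E par c P A \<Longrightarrow> means E par c Q B \<Longrightarrow> means E par c (P \<^bold>\<or> Q) (A \<or> B)"
  by (auto simp: means_def fImp_def fNot_def fOr_def fFls_def)

lemma means_Iff: "means E par c P A \<Longrightarrow> means E par c Q B \<Longrightarrow> means E par c (P \<^bold>\<longleftrightarrow> Q) (A \<longleftrightarrow> B)"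
  by (auto simp: means_def fImp_def fNot_def fAnd_def fIff_def fFls_def)

text \<open>The premise speaks of any term denoting \<open>x\<close>, not of the variable at the new
  level, so the rules compose without mentioning levels.\<close>

lemma means_All:
  assumes "\<And>c' t x. c \<preceq> c' \<Longrightarrow> denotes E par c' t x \<Longrightarrow> means E par c' (F t) (B x)"
  shows "means E par c (\<^bold>\<forall>x. F x) (\<forall>x. B x)"
  unfolding means_def
proof (intro allI impI)
  fix c' :: "'a ctx" assume c': "c \<preceq> c'"
  let ?c = "\<lambda>x. (Suc (fst c'), (snd c')(fst c' := x))"
  have "means E par (?c x) (F (Var (fst c'))) (B x)" for x
    by (rule assms[OF extends_trans[OF c' extends_push] denotes_push])
  then have "sat UNIV E (case_nat x (env par c')) (F (Var (fst c')) (Suc (fst c'))) \<longleftrightarrow> B x" for x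
    by (metis means_sat env_push fst_conv)
  then show "sat UNIV E (env par c') ((\<^bold>\<forall>x. F x) (fst c')) \<longleftrightarrow> (\<forall>x. B x)"
    by (simp add: fAll_def)
qed

lemma means_Ex:
  assumes "\<And>c' t x. c \<preceq> c' \<Longrightarrow> denotes E par c' t x \<Longrightarrow> means E par c' (F t) (B x)"
  shows "means E par c (\<^bold>\<exists>x. F x) (\<exists>x. B x)"
proof -
  have "means E par c (\<^bold>\<exists>x. F x) (\<not> (\<forall>x. \<not> B x))"
    unfolding fEx_def by (intro means_Not means_All assms)
  then show ?thesis by simp
qed

text \<open>Eliminating a description puts a quantifier over \<open>P\<close>. Since
  \<open>Q\<close> holds of \<open>x\<close> alone in every larger context, the quantified
  conjunction reduces to \<open>P\<close> at the value \<open>x\<close>.\<close>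

lemma means_elim_desc:
  assumes "denotes E par c t x"
    and "\<And>c' k. c \<preceq> c' \<Longrightarrow> k < fst c' \<Longrightarrow> snd c' k = x \<Longrightarrow> means E par c' (P k) B"
  shows "means E par c (elim_desc t P) B"
proof (cases t)
  case (Var l)
  then show ?thesis using assms by (simp add: denotes_def extends_refl)
next
  case (Desc Q)
  show ?thesis unfolding means_def
  proof (intro allI impI)
    fix c' :: "'a ctx" assume c': "c \<preceq> c'"
    let ?c = "\<lambda>y. (Suc (fst c'), (snd c')(fst c' := y))"
    have ext: "c \<preceq> ?c y" for y by (rule extends_trans[OF c' extends_push])
    have "means E par (?c y) (Q (fst c')) (y = x)" for y
      using assms(1) ext[of y] unfolding Desc denotes_def by fastforce
    then have Q: "sat UNIV E (case_nat y (env par c')) (Q (fst c') (Suc (fst c'))) \<longleftrightarrow> y = x" for y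
      by (metis means_sat env_push fst_conv)
    have "means E par (?c x) (P (fst c')) B"
      by (rule assms(2)[OF ext]) auto
    then have "sat UNIV E (case_nat x (env par c')) (P (fst c') (Suc (fst c'))) \<longleftrightarrow> B"
      by (metis means_sat env_push fst_conv)
    then show "sat UNIV E (env par c') (elim_desc t P (fst c')) \<longleftrightarrow> B"
      by (auto simp: Desc fEx_def fNot_def fAnd_def fImp_def fFls_def fAll_def Q)
  qed
qed

lemma means_Eq: "denotes E par c s x \<Longrightarrow> denotes E par c t y \<Longrightarrow> means E par c (s \<^bold>= t) (x = y)"
  unfolding fEq_def
  by (rule means_elim_desc, assumption, rule means_elim_desc, erule (1) denotes_mono)
    (auto simp: means_def env_def extends_def)

lemma means_Mem: "denotes E par c s x \<Longrightarrow> denotes E par c t y \<Longrightarrow> means E par c (s \<^bold>\<in> t) (E x y)"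
  unfolding fMem_def
  by (rule means_elim_desc, assumption, rule means_elim_desc, erule (1) denotes_mono)
    (auto simp: means_def env_def extends_def)

lemma means_app1:
  assumes "denotes E par c s x"
  shows "means E par c (app1 p s) (sat UNIV E (case_nat x par) p)"
  unfolding app1_def
proof (rule means_elim_desc[OF assms], unfold means_def, intro allI impI)
  fix c' c'' :: "'a ctx" and k
  assume "k < fst c'" "snd c' k = x" "c' \<preceq> c''"
  then have "(\<lambda>i. env par c'' (if i < length [k] then fst c'' - Suc ([k] ! i) else fst c'' + (i - length [k])))
      = case_nat x par"
    by (auto simp: fun_eq_iff env_def extends_def split: nat.split)
  then show "sat UNIV E (env par c'') (app p [k] (fst c'')) \<longleftrightarrow> sat UNIV E (case_nat x par) p"
    by (simp add: app_def sat_ren)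
qed

lemma means_app2:
  assumes "denotes E par c s x" "denotes E par c t y"
  shows "means E par c (app2 p s t) (sat UNIV E (case_nat x (case_nat y par)) p)"
  unfolding app2_def
proof (rule means_elim_desc[OF assms(1)], rule means_elim_desc, erule denotes_mono[OF _ assms(2)],
    unfold means_def, intro allI impI)
  fix c1 c' c'' :: "'a ctx" and k l
  assume "k < fst c1" "snd c1 k = x" "c1 \<preceq> c'" "l < fst c'" "snd c' l = y" "c' \<preceq> c''"
  then have "(\<lambda>i. env par c'' (if i < length [k, l] then fst c'' - Suc ([k, l] ! i)
      else fst c'' + (i - length [k, l]))) = case_nat x (case_nat y par)"
    by (auto simp: fun_eq_iff env_def extends_def less_Suc_eq nth_Cons split: nat.split)
  then show "sat UNIV E (env par c'') (app p [k, l] (fst c'')) \<longleftrightarrow>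
      sat UNIV E (case_nat x (case_nat y par)) p"
    by (simp add: app_def sat_ren)
qed

text \<open>The second premise packs existence and uniqueness of the set, which is what a
  description needs in order to denote.\<close>

lemma denotes_coll:
  assumes "\<And>c' t w. c \<preceq> c' \<Longrightarrow> denotes E par c' t w \<Longrightarrow> means E par c' (P t) (B w)"
    and "\<And>z. (\<forall>w. E w z \<longleftrightarrow> B w) \<longleftrightarrow> z = x"
  shows "denotes E par c (coll P) x"
  unfolding denotes_def coll_def trm.case
proof (intro allI impI, elim conjE)
  fix c' :: "'a ctx" and k
  assume c': "c \<preceq> c'" and k: "k < fst c'"
  have "denotes E par c' (Var k) (snd c' k)" using k by (simp add: denotes_def)
  then have "means E par c' (\<^bold>\<forall>w. w \<^bold>\<in> Var k \<^bold>\<longleftrightarrow> P w) (\<forall>w. E w (snd c' k) \<longleftrightarrow> B w)"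
    using c' by (intro means_All means_Iff means_Mem assms(1))
      (auto intro: denotes_mono extends_trans)
  then show "means E par c' (\<^bold>\<forall>w. w \<^bold>\<in> Var k \<^bold>\<longleftrightarrow> P w) (snd c' k = x)"
    by (simp add: assms(2))
qed

lemma sat_univ_closure_means:
  assumes "\<And>par c. means E par c P (B par)"
  shows "(\<forall>\<rho>. sat UNIV E \<rho> (univ_closure (P 0))) \<longleftrightarrow> (\<forall>par. B par)"
  \<comment> \<open>At depth 0 no level is ever read, hence \<open>undefined\<close>; every index is
    a parameter.\<close>
  unfolding sat_univ_closure using means_sat[OF assms[of _ "(0, undefined)"]]
  by (simp add: env_Nil)

text \<open>As introduction rules these compute a meaning along the syntax of a form, while
  \<open>denotes_mono\<close> carries earlier terms under later binders. The pattern recurs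
  throughout.\<close>

lemmas means_logic = means_Fls means_Imp means_Not means_And means_Or means_Iff means_All means_Ex
  means_Eq means_Mem means_app1 means_app2

section \<open>The axioms as statements about the relation\<close>

lemma sat_Extensionality:
  "(\<forall>\<rho>. sat UNIV E \<rho> Extensionality) \<longleftrightarrow> (\<forall>x y. (\<forall>z. E z x \<longleftrightarrow> E z y) \<longrightarrow> x = y)"
proof -
  have "(\<forall>\<rho>. sat UNIV E \<rho> Extensionality) \<longleftrightarrow>
    (\<forall>par :: nat \<Rightarrow> 'a. \<forall>x y. (\<forall>z. E z x \<longleftrightarrow> E z y) \<longrightarrow> x = y)"
    unfolding Extensionality_def
    by (rule sat_univ_closure_means)
       (rule means_logic | assumption | (rule denotes_mono, assumption))+
  then show ?thesis by simp
qed

lemma sat_Pairing: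
  "(\<forall>\<rho>. sat UNIV E \<rho> Pairing) \<longleftrightarrow> (\<forall>x y. \<exists>z. \<forall>w. E w z \<longleftrightarrow> w = x \<or> w = y)"
proof -
  have "(\<forall>\<rho>. sat UNIV E \<rho> Pairing) \<longleftrightarrow>
    (\<forall>par :: nat \<Rightarrow> 'a. \<forall>x y. \<exists>z. \<forall>w. E w z \<longleftrightarrow> w = x \<or> w = y)"
    unfolding Pairing_def
    by (rule sat_univ_closure_means)
       (rule means_logic | assumption | (rule denotes_mono, assumption))+
  then show ?thesis by simp
qed

lemma sat_Union_ax:
  "(\<forall>\<rho>. sat UNIV E \<rho> Union_ax) \<longleftrightarrow> (\<forall>x. \<exists>u. \<forall>z. E z u \<longleftrightarrow> (\<exists>y. E y x \<and> E z y))"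
proof -
  have "(\<forall>\<rho>. sat UNIV E \<rho> Union_ax) \<longleftrightarrow>
    (\<forall>par :: nat \<Rightarrow> 'a. \<forall>x. \<exists>u. \<forall>z. E z u \<longleftrightarrow> (\<exists>y. E y x \<and> E z y))"
    unfolding Union_ax_def
    by (rule sat_univ_closure_means)
       (rule means_logic | assumption | (rule denotes_mono, assumption))+
  then show ?thesis by simp
qed

lemma sat_Power_set:
  "(\<forall>\<rho>. sat UNIV E \<rho> Power_set) \<longleftrightarrow> (\<forall>x. \<exists>p. \<forall>y. E y p \<longleftrightarrow> (\<forall>z. E z y \<longrightarrow> E z x))"
proof -
  have "(\<forall>\<rho>. sat UNIV E \<rho> Power_set) \<longleftrightarrow>
    (\<forall>par :: nat \<Rightarrow> 'a. \<forall>x. \<exists>p. \<forall>y. E y p \<longleftrightarrow> (\<forall>z. E z y \<longrightarrow> E z x))"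
    unfolding Power_set_def
    by (rule sat_univ_closure_means)
       (rule means_logic | assumption | (rule denotes_mono, assumption))+
  then show ?thesis by simp
qed

lemma sat_Foundation:
  "(\<forall>\<rho>. sat UNIV E \<rho> Foundation) \<longleftrightarrow>
    (\<forall>x. (\<exists>y. E y x) \<longrightarrow> (\<exists>y. E y x \<and> \<not> (\<exists>z. E z x \<and> E z y)))"
proof -
  have "(\<forall>\<rho>. sat UNIV E \<rho> Foundation) \<longleftrightarrow>
    (\<forall>par :: nat \<Rightarrow> 'a. \<forall>x. (\<exists>y. E y x) \<longrightarrow> (\<exists>y. E y x \<and> \<not> (\<exists>z. E z x \<and> E z y)))"
    unfolding Foundation_def
    by (rule sat_univ_closure_means)
       (rule means_logic | assumption | (rule denotes_mono, assumption))+
  then show ?thesis by simp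
qed

lemma sat_Separation:
  "(\<forall>\<rho>. sat UNIV E \<rho> (Separation p)) \<longleftrightarrow>
    (\<forall>par a. \<exists>b. \<forall>x. E x b \<longleftrightarrow> E x a \<and> sat UNIV E (case_nat x par) p)"
  unfolding Separation_def
  by (rule sat_univ_closure_means)
     (rule means_logic | assumption | (rule denotes_mono, assumption))+

lemma sat_Replacement:
  "(\<forall>\<rho>. sat UNIV E \<rho> (Replacement p)) \<longleftrightarrow> (\<forall>par.
    (\<forall>x y z. sat UNIV E (case_nat x (case_nat y par)) p \<and> sat UNIV E (case_nat x (case_nat z par)) p
      \<longrightarrow> y = z) \<longrightarrow>
    (\<forall>a. \<exists>b. \<forall>y. E y b \<longleftrightarrow> (\<exists>x. E x a \<and> sat UNIV E (case_nat x (case_nat y par)) p)))"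
  unfolding Replacement_def
  by (rule sat_univ_closure_means)
     (rule means_logic | assumption | (rule denotes_mono, assumption))+

section \<open>The meaning of the defined notions\<close>

text \<open>These are the existence assumptions under which the descriptions of 0, pairs and
  adjunctions denote. Stated for any relation, they can be interpreted by the given membership and
  by the permuted one, so each notion has a twin with prefix \<open>N\<close>.\<close>

locale universe =
  fixes E :: "'a \<Rightarrow> 'a \<Rightarrow> bool" (infix "\<epsilon>" 50)
  assumes extensionality: "\<And>x y. (\<And>z. z \<epsilon> x \<longleftrightarrow> z \<epsilon> y) \<Longrightarrow> x = y"
    and empty_ex: "\<exists>z. \<forall>w. \<not> w \<epsilon> z"
    and upair_ex: "\<And>x y. \<exists>z. \<forall>w. w \<epsilon> z \<longleftrightarrow> w = x \<or> w = y"
    and adjoin_ex: "\<And>x y. \<exists>z. \<forall>w. w \<epsilon> z \<longleftrightarrow> w \<epsilon> x \<or> w = y"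
begin

definition the_set :: "('a \<Rightarrow> bool) \<Rightarrow> 'a" where
  "the_set B = (THE z. \<forall>w. w \<epsilon> z \<longleftrightarrow> B w)"

lemma the_set_iff: "\<exists>z. \<forall>w. w \<epsilon> z \<longleftrightarrow> B w \<Longrightarrow> (\<forall>w. w \<epsilon> z \<longleftrightarrow> B w) \<longleftrightarrow> z = the_set B"
proof -
  assume "\<exists>z. \<forall>w. w \<epsilon> z \<longleftrightarrow> B w"
  then obtain z' where z': "\<forall>w. w \<epsilon> z' \<longleftrightarrow> B w" by blast
  have u: "z = z'" if "\<forall>w. w \<epsilon> z \<longleftrightarrow> B w" for z
    using that z' by (intro extensionality) simp
  have "the_set B = z'" unfolding the_set_def using z' u by (rule the_equality)
  then show "(\<forall>w. w \<epsilon> z \<longleftrightarrow> B w) \<longleftrightarrow> z = the_set B"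
    using u z' by blast
qed

lemma mem_the_set: "\<exists>z. \<forall>w. w \<epsilon> z \<longleftrightarrow> B w \<Longrightarrow> w \<epsilon> the_set B \<longleftrightarrow> B w"
  using the_set_iff[of B "the_set B"] by simp

lemma denotes_coll_the_set:
  assumes "\<And>c' t w. c \<preceq> c' \<Longrightarrow> denotes E par c' t w \<Longrightarrow> means E par c' (P t) (B w)"
    and "\<exists>z. \<forall>w. w \<epsilon> z \<longleftrightarrow> B w"
  shows "denotes E par c (coll P) (the_set B)"
  using assms(1) the_set_iff[OF assms(2)] by (rule denotes_coll)

definition emp :: 'a where "emp = the_set (\<lambda>w. False)"
definition adj :: "'a \<Rightarrow> 'a \<Rightarrow> 'a" where "adj x y = the_set (\<lambda>w. w \<epsilon> x \<or> w = y)"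
definition sc :: "'a \<Rightarrow> 'a" where "sc x = adj x x"
definition upr :: "'a \<Rightarrow> 'a \<Rightarrow> 'a" where "upr x y = the_set (\<lambda>w. w = x \<or> w = y)"
definition opr :: "'a \<Rightarrow> 'a \<Rightarrow> 'a" where "opr x y = upr (upr x x) (upr x y)"
primrec nm :: "nat \<Rightarrow> 'a" where
  "nm 0 = emp"
| "nm (Suc k) = sc (nm k)"
definition tup :: "'a \<Rightarrow> 'a \<Rightarrow> 'a \<Rightarrow> 'a \<Rightarrow> 'a" where
  "tup m u r i = opr m (opr u (opr r i))"

lemma mem_emp [simp]: "\<not> w \<epsilon> emp"
  unfolding emp_def using empty_ex by (subst mem_the_set) auto

lemma mem_adj [simp]: "w \<epsilon> adj x y \<longleftrightarrow> w \<epsilon> x \<or> w = y"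
  unfolding adj_def using adjoin_ex by (subst mem_the_set) auto

lemma mem_sc [simp]: "w \<epsilon> sc x \<longleftrightarrow> w \<epsilon> x \<or> w = x"
  by (simp add: sc_def)

lemma mem_upr [simp]: "w \<epsilon> upr x y \<longleftrightarrow> w = x \<or> w = y"
  unfolding upr_def using upair_ex by (subst mem_the_set) auto

lemma mem_opr: "w \<epsilon> opr x y \<longleftrightarrow> w = upr x x \<or> w = upr x y"
  by (simp add: opr_def)

lemma upr_eq_iff: "upr x y = upr x' y' \<longleftrightarrow> x = x' \<and> y = y' \<or> x = y' \<and> y = x'"
proof
  assume "upr x y = upr x' y'"
  then have w: "w = x \<or> w = y \<longleftrightarrow> w = x' \<or> w = y'" for w
    using mem_upr[of w x y] mem_upr[of w x' y'] by simp
  show "x = x' \<and> y = y' \<or> x = y' \<and> y = x'"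
    using w[of x] w[of y] w[of x'] w[of y'] by auto
qed (auto intro: extensionality)

lemma opr_eq_iff [simp]: "opr x y = opr x' y' \<longleftrightarrow> x = x' \<and> y = y'"
  by (auto simp: opr_def upr_eq_iff)

lemma tup_eq_iff [simp]: "tup m u r i = tup m' u' r' i' \<longleftrightarrow> m = m' \<and> u = u' \<and> r = r' \<and> i = i'"
  by (auto simp: tup_def)

lemma denotes_zero: "denotes E par c zero emp"
  unfolding zero_def emp_def using empty_ex
  by (intro denotes_coll_the_set means_Fls) auto

lemma denotes_adjoin:
  "denotes E par c s x \<Longrightarrow> denotes E par c t y \<Longrightarrow> denotes E par c (adjoin s t) (adj x y)"
  unfolding adjoin_def adj_def
  by (intro denotes_coll_the_set means_logic adjoin_ex) (auto intro: denotes_mono)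

lemma denotes_suc: "denotes E par c s x \<Longrightarrow> denotes E par c (suc s) (sc x)"
  unfolding suc_def sc_def by (intro denotes_adjoin)

lemma denotes_num: "denotes E par c (num k) (nm k)"
  by (induction k) (auto intro: denotes_zero denotes_suc)

lemma denotes_upair:
  "denotes E par c s x \<Longrightarrow> denotes E par c t y \<Longrightarrow> denotes E par c (upair s t) (upr x y)"
  unfolding upair_def upr_def
  by (intro denotes_coll_the_set means_logic upair_ex) (auto intro: denotes_mono)

lemma denotes_opair:
  "denotes E par c s x \<Longrightarrow> denotes E par c t y \<Longrightarrow> denotes E par c \<langle>s, t\<rangle> (opr x y)"
  unfolding opair_def opr_def by (intro denotes_upair)

lemma denotes_tuple4:
  "denotes E par c s x \<Longrightarrow> denotes E par c t y \<Longrightarrow> denotes E par c s' x' \<Longrightarrow> denotes E par c t' y' \<Longrightarrow>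
    denotes E par c (tuple4 s t s' t') (tup x y x' y')"
  unfolding tuple4_def tup_def by (intro denotes_opair)

lemmas denotes_terms = denotes_zero denotes_adjoin denotes_suc denotes_num denotes_upair
  denotes_opair denotes_tuple4

text \<open>The HOL notions from here on copy the forms clause by clause, so that the
  \<open>means_\<close> lemmas match the two sides by syntax alone.\<close>

definition isfun :: "'a \<Rightarrow> 'a \<Rightarrow> 'a \<Rightarrow> bool" where
  "isfun f a b \<longleftrightarrow> (\<forall>z. z \<epsilon> f \<longrightarrow> (\<exists>x y. x \<epsilon> a \<and> y \<epsilon> b \<and> z = opr x y)) \<and>
     (\<forall>x. x \<epsilon> a \<longrightarrow> (\<exists>y. opr x y \<epsilon> f \<and> (\<forall>y'. opr x y' \<epsilon> f \<longrightarrow> y' = y)))"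

definition isind :: "'a \<Rightarrow> bool" where
  "isind w \<longleftrightarrow> emp \<epsilon> w \<and> (\<forall>x. x \<epsilon> w \<longrightarrow> sc x \<epsilon> w)"

definition isnat :: "'a \<Rightarrow> bool" where
  "isnat n \<longleftrightarrow> (\<forall>w. isind w \<longrightarrow> n \<epsilon> w)"

definition isstruct :: "'a \<Rightarrow> 'a \<Rightarrow> bool" where
  "isstruct a s \<longleftrightarrow> (\<exists>m u r i. s = tup m u r i \<and> (\<forall>x. x \<epsilon> u \<longrightarrow> x \<epsilon> m) \<and>
     (\<forall>z. z \<epsilon> r \<longrightarrow> (\<exists>x y. x \<epsilon> m \<and> y \<epsilon> m \<and> z = opr x y)) \<and> isfun i a m)"

definition "varc i = opr (nm 0) i"
definition "constc c = opr (nm 1) c"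
definition "eqc s t = opr (nm 0) (opr s t)"
definition "Uc t = opr (nm 1) t"
definition "Rc s t = opr (nm 2) (opr s t)"
definition "notc p = opr (nm 3) p"
definition "andc p q = opr (nm 4) (opr p q)"
definition "exc p = opr (nm 5) p"

lemma denotes_codes:
  "denotes E par c s x \<Longrightarrow> denotes E par c (var_code s) (varc x)"
  "denotes E par c s x \<Longrightarrow> denotes E par c (const_code s) (constc x)"
  "denotes E par c s x \<Longrightarrow> denotes E par c t y \<Longrightarrow> denotes E par c (eq_code s t) (eqc x y)"
  "denotes E par c s x \<Longrightarrow> denotes E par c (U_code s) (Uc x)"
  "denotes E par c s x \<Longrightarrow> denotes E par c t y \<Longrightarrow> denotes E par c (R_code s t) (Rc x y)"
  "denotes E par c s x \<Longrightarrow> denotes E par c (not_code s) (notc x)"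
  "denotes E par c s x \<Longrightarrow> denotes E par c t y \<Longrightarrow> denotes E par c (and_code s t) (andc x y)"
  "denotes E par c s x \<Longrightarrow> denotes E par c (ex_code s) (exc x)"
  unfolding var_code_def varc_def const_code_def constc_def eq_code_def eqc_def U_code_def Uc_def
    R_code_def Rc_def not_code_def notc_def and_code_def andc_def ex_code_def exc_def
  by (intro denotes_opair denotes_num; assumption)+

definition isterm :: "'a \<Rightarrow> 'a \<Rightarrow> 'a \<Rightarrow> bool" where
  "isterm a n t \<longleftrightarrow> (\<exists>i. i \<epsilon> n \<and> t = varc i) \<or> (\<exists>c. c \<epsilon> a \<and> t = constc c)"

definition isformclosed :: "'a \<Rightarrow> 'a \<Rightarrow> bool" where
  "isformclosed a F \<longleftrightarrow> (\<forall>n. isnat n \<longrightarrow>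
     (\<forall>s t. isterm a n s \<and> isterm a n t \<longrightarrow> opr n (eqc s t) \<epsilon> F) \<and>
     (\<forall>t. isterm a n t \<longrightarrow> opr n (Uc t) \<epsilon> F) \<and>
     (\<forall>s t. isterm a n s \<and> isterm a n t \<longrightarrow> opr n (Rc s t) \<epsilon> F) \<and>
     (\<forall>p. opr n p \<epsilon> F \<longrightarrow> opr n (notc p) \<epsilon> F) \<and>
     (\<forall>p q. opr n p \<epsilon> F \<and> opr n q \<epsilon> F \<longrightarrow> opr n (andc p q) \<epsilon> F) \<and>
     (\<forall>p. opr (sc n) p \<epsilon> F \<longrightarrow> opr n (exc p) \<epsilon> F))"

definition isform :: "'a \<Rightarrow> 'a \<Rightarrow> 'a \<Rightarrow> bool" where
  "isform a n p \<longleftrightarrow> isnat n \<and> (\<forall>F. isformclosed a F \<longrightarrow> opr n p \<epsilon> F)"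

definition isval :: "'a \<Rightarrow> 'a \<Rightarrow> 'a \<Rightarrow> 'a \<Rightarrow> bool" where
  "isval i e t x \<longleftrightarrow>
    (\<exists>k. t = varc k \<and> opr k x \<epsilon> e) \<or> (\<exists>c. t = constc c \<and> opr c x \<epsilon> i)"

definition issatrel :: "'a \<Rightarrow> 'a \<Rightarrow> 'a \<Rightarrow> 'a \<Rightarrow> 'a \<Rightarrow> 'a \<Rightarrow> bool" where
  "issatrel a m u r i S \<longleftrightarrow> (\<forall>n e. isnat n \<and> isfun e n m \<longrightarrow>
     (\<forall>s t. isterm a n s \<and> isterm a n t \<longrightarrow>
        (opr (eqc s t) e \<epsilon> S \<longleftrightarrow> (\<exists>x. isval i e s x \<and> isval i e t x))) \<and>
     (\<forall>t. isterm a n t \<longrightarrow>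
        (opr (Uc t) e \<epsilon> S \<longleftrightarrow> (\<exists>x. isval i e t x \<and> x \<epsilon> u))) \<and>
     (\<forall>s t. isterm a n s \<and> isterm a n t \<longrightarrow>
        (opr (Rc s t) e \<epsilon> S \<longleftrightarrow>
          (\<exists>x y. isval i e s x \<and> isval i e t y \<and> opr x y \<epsilon> r))) \<and>
     (\<forall>p. isform a n p \<longrightarrow>
        (opr (notc p) e \<epsilon> S \<longleftrightarrow> \<not> opr p e \<epsilon> S)) \<and>
     (\<forall>p q. isform a n p \<and> isform a n q \<longrightarrow>
        (opr (andc p q) e \<epsilon> S \<longleftrightarrow> opr p e \<epsilon> S \<and> opr q e \<epsilon> S)) \<and>
     (\<forall>p. isform a (sc n) p \<longrightarrow>
        (opr (exc p) e \<epsilon> S \<longleftrightarrow> (\<exists>x. x \<epsilon> m \<and> opr p (adj e (opr n x)) \<epsilon> S))))"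

definition sats :: "'a \<Rightarrow> 'a \<Rightarrow> 'a \<Rightarrow> 'a \<Rightarrow> 'a \<Rightarrow> 'a \<Rightarrow> 'a \<Rightarrow> bool" where
  "sats a m u r i p e \<longleftrightarrow> (\<exists>S. issatrel a m u r i S \<and> opr p e \<epsilon> S)"

definition in_comp :: "'a \<Rightarrow> 'a \<Rightarrow> 'a \<Rightarrow> bool" where
  "in_comp f e w \<longleftrightarrow> (\<exists>k x y. opr k x \<epsilon> e \<and> opr x y \<epsilon> f \<and> w = opr k y)"

definition comp :: "'a \<Rightarrow> 'a \<Rightarrow> 'a" where
  "comp f e = the_set (in_comp f e)"

definition iselem :: "'a \<Rightarrow> 'a \<Rightarrow> 'a \<Rightarrow> 'a \<Rightarrow> bool" where
  "iselem a f M N \<longleftrightarrow> (\<exists>m u r i m' u' r' i'.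
     M = tup m u r i \<and> N = tup m' u' r' i' \<and> isfun f m m' \<and>
     (\<forall>n p e. isform a n p \<and> isfun e n m \<longrightarrow>
        (sats a m u r i p e \<longleftrightarrow> sats a m' u' r' i' p (comp f e))))"

lemma means_is_fun:
  "denotes E par c f f' \<Longrightarrow> denotes E par c a a' \<Longrightarrow> denotes E par c b b' \<Longrightarrow>
    means E par c (is_fun f a b) (isfun f' a' b')"
  unfolding is_fun_def isfun_def
  by (rule means_logic | assumption | rule denotes_terms | (rule denotes_mono, assumption))+

lemma means_is_inductive:
  "denotes E par c w w' \<Longrightarrow> means E par c (is_inductive w) (isind w')"
  unfolding is_inductive_def isind_def
  by (rule means_logic | assumption | rule denotes_terms | (rule denotes_mono, assumption))+

lemma means_is_nat:
  "denotes E par c n n' \<Longrightarrow> means E par c (is_nat n) (isnat n')"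
  unfolding is_nat_def isnat_def
  by (rule means_logic means_is_inductive | assumption | rule denotes_terms
      | (rule denotes_mono, assumption))+

lemma means_is_structure:
  "denotes E par c a a' \<Longrightarrow> denotes E par c s s' \<Longrightarrow> means E par c (is_structure a s) (isstruct a' s')"
  unfolding is_structure_def isstruct_def
  by (rule means_logic means_is_fun | assumption | rule denotes_terms
      | (rule denotes_mono, assumption))+

lemma means_is_term:
  "denotes E par c a a' \<Longrightarrow> denotes E par c n n' \<Longrightarrow> denotes E par c t t' \<Longrightarrow>
    means E par c (is_term a n t) (isterm a' n' t')"
  unfolding is_term_def isterm_def
  by (rule means_logic | assumption | rule denotes_codes | (rule denotes_mono, assumption))+

lemma means_formation_closed:
  "denotes E par c a a' \<Longrightarrow> denotes E par c F F' \<Longrightarrow>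
    means E par c (formation_closed a F) (isformclosed a' F')"
  unfolding formation_closed_def isformclosed_def
  by (rule means_logic means_is_nat means_is_term | assumption | rule denotes_terms denotes_codes
      | (rule denotes_mono, assumption))+

lemma means_is_formula:
  "denotes E par c a a' \<Longrightarrow> denotes E par c n n' \<Longrightarrow> denotes E par c p p' \<Longrightarrow>
    means E par c (is_formula a n p) (isform a' n' p')"
  unfolding is_formula_def isform_def
  by (rule means_logic means_is_nat means_formation_closed | assumption
      | rule denotes_terms | (rule denotes_mono, assumption))+

lemma means_is_value:
  "denotes E par c i i' \<Longrightarrow> denotes E par c e e' \<Longrightarrow> denotes E par c t t' \<Longrightarrow> denotes E par c x x' \<Longrightarrow>
    means E par c (is_value i e t x) (isval i' e' t' x')"
  unfolding is_value_def isval_def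
  by (rule means_logic | assumption | rule denotes_terms denotes_codes
      | (rule denotes_mono, assumption))+

lemma means_is_sat_relation:
  "denotes E par c a a' \<Longrightarrow> denotes E par c m m' \<Longrightarrow> denotes E par c u u' \<Longrightarrow> denotes E par c r r' \<Longrightarrow>
    denotes E par c i i' \<Longrightarrow> denotes E par c S S' \<Longrightarrow>
    means E par c (is_sat_relation a m u r i S) (issatrel a' m' u' r' i' S')"
  unfolding is_sat_relation_def issatrel_def
  by (rule means_logic means_is_nat means_is_fun means_is_term means_is_formula means_is_value
      | assumption | rule denotes_terms denotes_codes | (rule denotes_mono, assumption))+

lemma means_satisfies:
  "denotes E par c a a' \<Longrightarrow> denotes E par c m m' \<Longrightarrow> denotes E par c u u' \<Longrightarrow> denotes E par c r r' \<Longrightarrow>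
    denotes E par c i i' \<Longrightarrow> denotes E par c p p' \<Longrightarrow> denotes E par c e e' \<Longrightarrow>
    means E par c (satisfies a m u r i p e) (sats a' m' u' r' i' p' e')"
  unfolding satisfies_def sats_def
  by (rule means_logic means_is_sat_relation
      | assumption | rule denotes_terms | (rule denotes_mono, assumption))+

lemma sat_Infinity: "(\<forall>\<rho>. sat UNIV E \<rho> Infinity) \<longleftrightarrow> (\<exists>w. isind w)"
proof -
  have "(\<forall>\<rho>. sat UNIV E \<rho> Infinity) \<longleftrightarrow> (\<forall>par :: nat \<Rightarrow> 'a. \<exists>w. isind w)"
    unfolding Infinity_def
    by (rule sat_univ_closure_means) (intro means_Ex means_is_inductive)
  then show ?thesis by simp
qed

lemma sat_Choice:
  "(\<forall>\<rho>. sat UNIV E \<rho> Choice) \<longleftrightarrow> (\<forall>a. (\<forall>x. x \<epsilon> a \<longrightarrow> (\<exists>y. y \<epsilon> x)) \<longrightarrow>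
    (\<exists>f b. isfun f a b \<and> (\<forall>x y. opr x y \<epsilon> f \<longrightarrow> y \<epsilon> x)))"
proof -
  have "(\<forall>\<rho>. sat UNIV E \<rho> Choice) \<longleftrightarrow> (\<forall>par :: nat \<Rightarrow> 'a. \<forall>a. (\<forall>x. x \<epsilon> a \<longrightarrow> (\<exists>y. y \<epsilon> x)) \<longrightarrow>
    (\<exists>f b. isfun f a b \<and> (\<forall>x y. opr x y \<epsilon> f \<longrightarrow> y \<epsilon> x)))"
    unfolding Choice_def
    by (rule sat_univ_closure_means)
       (rule means_logic means_is_fun | assumption | rule denotes_terms
        | (rule denotes_mono, assumption))+
  then show ?thesis by simp
qed

text \<open>Kept apart from \<open>comp\<close>, because the existence of the composite is itself
  obtained by Separation for this form.\<close>

lemma means_in_comp: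
  "denotes E par c f f' \<Longrightarrow> denotes E par c e e' \<Longrightarrow> denotes E par c w w' \<Longrightarrow>
    means E par c (\<^bold>\<exists>k. \<^bold>\<exists>x. \<^bold>\<exists>y. \<langle>k, x\<rangle> \<^bold>\<in> e \<^bold>\<and> \<langle>x, y\<rangle> \<^bold>\<in> f \<^bold>\<and> w \<^bold>= \<langle>k, y\<rangle>) (in_comp f' e' w')"
  unfolding in_comp_def
  by (rule means_logic | assumption | rule denotes_terms | (rule denotes_mono, assumption))+

end

locale universe_comp = universe +
  assumes comp_ex: "\<And>f e. \<exists>z. \<forall>w. w \<epsilon> z \<longleftrightarrow> in_comp f e w"
begin

lemma mem_comp: "w \<epsilon> comp f e \<longleftrightarrow> in_comp f e w"
  unfolding comp_def using comp_ex by (rule mem_the_set)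

lemma denotes_fun_comp:
  "denotes E par c f f' \<Longrightarrow> denotes E par c e e' \<Longrightarrow> denotes E par c (fun_comp f e) (comp f' e')"
  unfolding fun_comp_def comp_def
  by (rule denotes_coll_the_set, rule means_in_comp)
     (assumption | rule comp_ex | (rule denotes_mono, assumption))+

lemma means_is_elementary_embedding:
  "denotes E par c a a' \<Longrightarrow> denotes E par c f f' \<Longrightarrow> denotes E par c M M' \<Longrightarrow> denotes E par c N N' \<Longrightarrow>
    means E par c (is_elementary_embedding a f M N) (iselem a' f' M' N')"
  unfolding is_elementary_embedding_def iselem_def
  by (rule means_logic means_is_formula means_is_fun means_satisfies
      | assumption | rule denotes_terms denotes_fun_comp | (rule denotes_mono, assumption))+

definition Vopenka_for :: "('a \<Rightarrow> bool) \<Rightarrow> bool" where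
  "Vopenka_for X \<longleftrightarrow> (\<forall>a. (\<forall>x. \<exists>y. (X y \<and> \<not> y \<epsilon> x) \<or> (\<not> X y \<and> y \<epsilon> x)) \<and> (\<forall>x. X x \<longrightarrow> isstruct a x) \<longrightarrow>
     (\<exists>M N. X M \<and> X N \<and> \<not> M = N \<and> (\<exists>f. iselem a f M N)))"

lemma sat_Vopenka:
  "(\<forall>\<rho>. sat UNIV E \<rho> (Vopenka p)) \<longleftrightarrow> (\<forall>par. Vopenka_for (\<lambda>x. sat UNIV E (case_nat x par) p))"
  unfolding Vopenka_def Vopenka_for_def is_proper_class_def
  by (rule sat_univ_closure_means)
     (rule means_logic means_is_structure means_is_elementary_embedding
      | assumption | rule denotes_terms | (rule denotes_mono, assumption))+

end

section \<open>Definability of HOL predicates\<close>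

text \<open>The form is opened at a new level, which becomes index 0; the values of the levels in
  \<open>c\<close> turn into parameters of the formula.\<close>

lemma definable_by_formula:
  assumes "\<And>c' t x. c \<preceq> c' \<Longrightarrow> denotes E par c' t x \<Longrightarrow> means E par c' (F t) (B x)"
  shows "\<exists>p par'. \<forall>x. sat UNIV E (case_nat x par') p \<longleftrightarrow> B x"
proof -
  have "means E par (Suc (fst c), (snd c)(fst c := x)) (F (Var (fst c))) (B x)" for x
    by (rule assms[OF extends_push denotes_push])
  then have "sat UNIV E (case_nat x (env par c)) (F (Var (fst c)) (Suc (fst c))) \<longleftrightarrow> B x" for x
    by (metis means_sat env_push fst_conv)
  then show ?thesis by blast
qed

lemma definable_by_formula2:
  assumes "\<And>c' s t x y. c \<preceq> c' \<Longrightarrow> denotes E par c' s x \<Longrightarrow> denotes E par c' t y \<Longrightarrow>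
    means E par c' (F s t) (R x y)"
  shows "\<exists>p par'. \<forall>x y. sat UNIV E (case_nat x (case_nat y par')) p \<longleftrightarrow> R x y"
proof -
  \<comment> \<open>\<open>y\<close> is pushed first, so that \<open>x\<close>, pushed last, gets
    index 0 and \<open>y\<close> index 1.\<close>
  define c1 where "c1 y = (Suc (fst c), (snd c)(fst c := y))" for y
  define c2 where "c2 x y = (Suc (fst (c1 y)), (snd (c1 y))(fst (c1 y) := x))" for x y
  have "means E par (c2 x y) (F (Var (Suc (fst c))) (Var (fst c))) (R x y)" for x y
    by (rule assms) (auto simp: extends_def denotes_def c1_def c2_def)
  moreover have "env par (c2 x y) = case_nat x (case_nat y (env par c))" for x y
    unfolding c2_def env_push unfolding c1_def env_push ..
  moreover have "fst (c2 x y) = Suc (Suc (fst c))" for x y by (simp add: c1_def c2_def)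
  ultimately have "sat UNIV E (case_nat x (case_nat y (env par c)))
      (F (Var (Suc (fst c))) (Var (fst c)) (Suc (Suc (fst c)))) \<longleftrightarrow> R x y" for x y
    by (metis means_sat)
  then show ?thesis by blast
qed

text \<open>Levels 0 and 1 will hold the sets from which a predicate is defined: the two swapped
  points, or the two factors of a composition.\<close>

lemma context_with_two_values:
  obtains c where "denotes E par c (Var 0) x" "denotes E par c (Var 1) y"
proof
  let ?c = "(2, \<lambda>l. if l = 0 then x else y)"
  show "denotes E par ?c (Var 0) x" "denotes E par ?c (Var 1) y"
    by (simp_all add: denotes_def)
qed

definition Ite :: "fm \<Rightarrow> fm \<Rightarrow> fm \<Rightarrow> fm" where
  "Ite p q r = Imp (Imp (Imp p q) (Imp (Imp (Imp p Fls) r) Fls)) Fls"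

lemma sat_Ite: "sat D E \<rho> (Ite p q r) \<longleftrightarrow> (if sat D E \<rho> p then sat D E \<rho> q else sat D E \<rho> r)"
  by (auto simp: Ite_def)

section \<open>The permutation model\<close>

locale zf0_model =
  fixes E :: "'a \<Rightarrow> 'a \<Rightarrow> bool" (infix "\<epsilon>" 50)
  assumes sat_ZF0: "\<And>p \<rho>. p \<in> ZF0 \<Longrightarrow> sat UNIV E \<rho> p"
begin

lemma sat_ZF0_axioms:
  "\<forall>\<rho>. sat UNIV E \<rho> Extensionality" "\<forall>\<rho>. sat UNIV E \<rho> Pairing" "\<forall>\<rho>. sat UNIV E \<rho> Union_ax"
  "\<forall>\<rho>. sat UNIV E \<rho> Power_set" "\<forall>\<rho>. sat UNIV E \<rho> Infinity"
  "\<forall>\<rho>. sat UNIV E \<rho> (Separation p)" "\<forall>\<rho>. sat UNIV E \<rho> (Replacement p)"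
  using sat_ZF0 by (auto simp: ZF0_def)

lemmas pairing = sat_ZF0_axioms(2)[unfolded sat_Pairing, rule_format]
  and union = sat_ZF0_axioms(3)[unfolded sat_Union_ax, rule_format]
  and power = sat_ZF0_axioms(4)[unfolded sat_Power_set, rule_format]

lemma separation:
  assumes "\<And>c' t x. c \<preceq> c' \<Longrightarrow> denotes E par c' t x \<Longrightarrow> means E par c' (F t) (B x)"
  shows "\<exists>b. \<forall>x. x \<epsilon> b \<longleftrightarrow> x \<epsilon> a \<and> B x"
proof -
  obtain p par' where "\<And>x. sat UNIV E (case_nat x par') p \<longleftrightarrow> B x"
    using definable_by_formula[of c E par F B, OF assms] by blast
  then show ?thesis
    using sat_ZF0_axioms(6)[of p, unfolded sat_Separation, rule_format, of a par'] by simp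
qed

lemma replacement:
  assumes "\<And>c' s t x y. c \<preceq> c' \<Longrightarrow> denotes E par c' s x \<Longrightarrow> denotes E par c' t y \<Longrightarrow>
      means E par c' (F s t) (R x y)"
    and "\<And>x y z. R x y \<Longrightarrow> R x z \<Longrightarrow> y = z"
  shows "\<exists>b. \<forall>y. y \<epsilon> b \<longleftrightarrow> (\<exists>x. x \<epsilon> a \<and> R x y)"
proof -
  obtain p par' where "\<And>x y. sat UNIV E (case_nat x (case_nat y par')) p \<longleftrightarrow> R x y"
    using definable_by_formula2[of c E par F R, OF assms(1)] by blast
  then show ?thesis
    using sat_ZF0_axioms(7)[of p, unfolded sat_Replacement, THEN spec, of par'] assms(2) by simp blast
qed

lemma union2: "\<exists>u. \<forall>z. z \<epsilon> u \<longleftrightarrow> z \<epsilon> x \<or> z \<epsilon> y"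
proof -
  obtain v where v: "\<forall>w. w \<epsilon> v \<longleftrightarrow> w = x \<or> w = y" using pairing by blast
  obtain u where "\<forall>z. z \<epsilon> u \<longleftrightarrow> (\<exists>y. y \<epsilon> v \<and> z \<epsilon> y)" using union by blast
  with v show ?thesis by auto
qed

sublocale universe
proof
  show "x = y" if "\<And>z. z \<epsilon> x \<longleftrightarrow> z \<epsilon> y" for x y
    using sat_ZF0_axioms(1)[unfolded sat_Extensionality] that by blast
  show "\<exists>z. \<forall>w. \<not> w \<epsilon> z"
    using separation[OF means_Fls] by simp
  show "\<exists>z. \<forall>w. w \<epsilon> z \<longleftrightarrow> w = x \<or> w = y" for x y by (rule pairing)
  show "\<exists>z. \<forall>w. w \<epsilon> z \<longleftrightarrow> w \<epsilon> x \<or> w = y" for x y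
  proof -
    obtain v where "\<forall>w. w \<epsilon> v \<longleftrightarrow> w = y" using pairing[of y y] by auto
    then show ?thesis using union2[of x v] by auto
  qed
qed

sublocale universe_comp
proof
  fix f e
  \<comment> \<open>A Kuratowski pair holds its components two levels down, so two unions collect
    them; conversely, pairs over \<open>g\<close> lie in its double power set. This bounds the
    composite by a set.\<close>
  obtain e1 where e1: "\<And>z. z \<epsilon> e1 \<longleftrightarrow> (\<exists>y. y \<epsilon> e \<and> z \<epsilon> y)" using union by metis
  obtain e2 where e2: "\<And>z. z \<epsilon> e2 \<longleftrightarrow> (\<exists>y. y \<epsilon> e1 \<and> z \<epsilon> y)" using union by metis
  obtain f1 where f1: "\<And>z. z \<epsilon> f1 \<longleftrightarrow> (\<exists>y. y \<epsilon> f \<and> z \<epsilon> y)" using union by metis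
  obtain f2 where f2: "\<And>z. z \<epsilon> f2 \<longleftrightarrow> (\<exists>y. y \<epsilon> f1 \<and> z \<epsilon> y)" using union by metis
  obtain g where g: "\<And>z. z \<epsilon> g \<longleftrightarrow> z \<epsilon> e2 \<or> z \<epsilon> f2" using union2 by metis
  obtain p where p: "\<And>y. y \<epsilon> p \<longleftrightarrow> (\<forall>z. z \<epsilon> y \<longrightarrow> z \<epsilon> g)" using power by metis
  obtain p2 where p2: "\<And>y. y \<epsilon> p2 \<longleftrightarrow> (\<forall>z. z \<epsilon> y \<longrightarrow> z \<epsilon> p)" using power by metis
  have bound: "w \<epsilon> p2" if "in_comp f e w" for w
  proof -
    obtain k x y where kxy: "opr k x \<epsilon> e" "opr x y \<epsilon> f" "w = opr k y"
      using \<open>in_comp f e w\<close> unfolding in_comp_def by blast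
    have "upr k k \<epsilon> e1" using kxy(1) unfolding e1 by (intro exI[of _ "opr k x"]) (simp add: mem_opr)
    then have k: "k \<epsilon> g" unfolding g e2 by (intro disjI1 exI[of _ "upr k k"]) simp
    have "upr x y \<epsilon> f1" using kxy(2) unfolding f1 by (intro exI[of _ "opr x y"]) (simp add: mem_opr)
    then have y: "y \<epsilon> g" unfolding g f2 by (intro disjI2 exI[of _ "upr x y"]) simp
    show ?thesis using k y unfolding p2 p by (auto simp: kxy(3) mem_opr)
  qed
  obtain c where c: "denotes E undefined c (Var 0) f" "denotes E undefined c (Var 1) e"
    by (rule context_with_two_values)
  have "\<exists>b. \<forall>w. w \<epsilon> b \<longleftrightarrow> w \<epsilon> p2 \<and> in_comp f e w"
    by (rule separation[where c = c], rule means_in_comp) (auto intro: denotes_mono c)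
  then show "\<exists>z. \<forall>w. w \<epsilon> z \<longleftrightarrow> in_comp f e w" using bound by blast
qed

lemma omega_ex: "\<exists>b. \<forall>n. n \<epsilon> b \<longleftrightarrow> isnat n"
proof -
  obtain w where "isind w" using sat_ZF0_axioms(5) sat_Infinity by blast
  then have "n \<epsilon> w" if "isnat n" for n using that by (simp add: isnat_def)
  moreover have "\<exists>b. \<forall>n. n \<epsilon> b \<longleftrightarrow> n \<epsilon> w \<and> isnat n"
    by (rule separation, rule means_is_nat)
  ultimately show ?thesis by blast
qed

lemma isnat_emp: "isnat emp"
  by (simp add: isnat_def isind_def)

lemma isnat_sc: "isnat n \<Longrightarrow> isnat (sc n)"
  by (simp add: isnat_def isind_def)

lemma isnat_nm: "isnat (nm k)"
  by (induction k) (auto intro: isnat_emp isnat_sc)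

text \<open>Induction inside the model: Separation cuts the naturals with the property out of the
  set of all naturals, and they form an inductive set. This will keep naturals fixed by
  \<open>\<pi>\<close>.\<close>

lemma isnat_cases: "isnat n \<Longrightarrow> n = emp \<or> emp \<epsilon> n"
proof -
  assume n: "isnat n"
  obtain w where w: "\<And>n. n \<epsilon> w \<longleftrightarrow> isnat n" using omega_ex by blast
  have "\<exists>b. \<forall>x. x \<epsilon> b \<longleftrightarrow> x \<epsilon> w \<and> (x = emp \<or> emp \<epsilon> x)"
    by (rule separation[where F = "\<lambda>t. t \<^bold>= zero \<^bold>\<or> zero \<^bold>\<in> t"]) (intro means_logic denotes_zero)
  then obtain b where b: "\<And>x. x \<epsilon> b \<longleftrightarrow> isnat x \<and> (x = emp \<or> emp \<epsilon> x)" by (auto simp: w)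
  then have "isind b" by (auto simp: isind_def isnat_emp isnat_sc)
  then show ?thesis using n b unfolding isnat_def by blast
qed


text \<open>The points \<open>{1, 2, 3}\<close> and \<open>{1, 2, pnt}\<close> swapped by \<open>\<pi>\<close> are nonempty without the element \<open>0\<close>, so
  they are no natural numbers; they have three elements, so they are no unordered pairs; and their
  element \<open>1\<close> is no ordered pair, so they are no relations. Hence \<open>\<pi>\<close> fixes all pairs, numerals,
  codes and assignments.\<close>

definition pnt :: 'a where "pnt = adj (upr (nm 1) (nm 2)) (nm 3)"
definition qnt :: 'a where "qnt = adj (upr (nm 1) (nm 2)) pnt"
definition \<pi> :: "'a \<Rightarrow> 'a" where "\<pi> x = (if x = pnt then qnt else if x = qnt then pnt else x)"
definition pm :: "'a \<Rightarrow> 'a \<Rightarrow> bool" where "pm x y \<longleftrightarrow> x \<epsilon> \<pi> y"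

lemma mem_pnt: "w \<epsilon> pnt \<longleftrightarrow> w = nm 1 \<or> w = nm 2 \<or> w = nm 3"
  by (auto simp: pnt_def)

lemma mem_qnt: "w \<epsilon> qnt \<longleftrightarrow> w = nm 1 \<or> w = nm 2 \<or> w = pnt"
  by (auto simp: qnt_def)

lemma mem_nm:
  "w \<epsilon> nm 1 \<longleftrightarrow> w = emp" "w \<epsilon> nm 2 \<longleftrightarrow> w = emp \<or> w = nm 1"
  "w \<epsilon> nm 3 \<longleftrightarrow> w = emp \<or> w = nm 1 \<or> w = nm 2"
  by (auto simp: numeral_2_eq_2 numeral_3_eq_3)

lemma nm_neq: "nm 1 \<noteq> emp" "nm 2 \<noteq> emp" "nm 3 \<noteq> emp" "nm 1 \<noteq> nm 2" "nm 1 \<noteq> nm 3" "nm 2 \<noteq> nm 3"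
proof -
  show 1: "nm 1 \<noteq> emp" "nm 2 \<noteq> emp" "nm 3 \<noteq> emp" using mem_nm[of emp] mem_emp[of emp] by metis+
  show 2: "nm 1 \<noteq> nm 2" using mem_nm(1,2)[of "nm 1"] 1 by metis
  show "nm 1 \<noteq> nm 3" using mem_nm(1,3)[of "nm 1"] 1 by metis
  show "nm 2 \<noteq> nm 3" using mem_nm(2,3)[of "nm 2"] 1 2 by metis
qed

lemma emp_not_in_pnt_qnt: "\<not> emp \<epsilon> pnt" "\<not> emp \<epsilon> qnt"
proof -
  show "\<not> emp \<epsilon> pnt" using nm_neq(1-3) unfolding mem_pnt by metis
  moreover have "pnt \<noteq> emp" using mem_pnt[of "nm 1"] mem_emp[of "nm 1"] by metis
  ultimately show "\<not> emp \<epsilon> qnt" using nm_neq(1-3) unfolding mem_qnt by metis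
qed

lemma pnt_neq: "pnt \<noteq> nm 1" "pnt \<noteq> nm 2" "pnt \<noteq> nm 3" "pnt \<noteq> qnt"
proof -
  show 1: "pnt \<noteq> nm 1" "pnt \<noteq> nm 2" "pnt \<noteq> nm 3"
    using emp_not_in_pnt_qnt(1) mem_nm[of emp] by metis+
  show "pnt \<noteq> qnt" using mem_pnt[of "nm 3"] mem_qnt[of "nm 3"] nm_neq 1 by metis
qed

lemma pi_pi [simp]: "\<pi> (\<pi> x) = x"
  by (simp add: \<pi>_def)

lemma pi_eq_iff [simp]: "\<pi> x = \<pi> y \<longleftrightarrow> x = y"
  by (metis pi_pi)

lemma all_pi: "(\<forall>x. B (\<pi> x)) \<longleftrightarrow> (\<forall>x. B x)"
  by (metis pi_pi)

lemma ex_pi: "(\<exists>x. B (\<pi> x)) \<longleftrightarrow> (\<exists>x. B x)"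
  by (metis pi_pi)

text \<open>Both swapped points contain 1 and 2 and omit the empty set, so each disjunct excludes
  both.\<close>

lemma pi_fixes:
  assumes "emp \<epsilon> x \<or> \<not> nm 1 \<epsilon> x \<or> \<not> nm 2 \<epsilon> x"
  shows "\<pi> x = x"
  using assms emp_not_in_pnt_qnt by (auto simp: \<pi>_def mem_pnt mem_qnt)

lemma pi_emp [simp]: "\<pi> emp = emp"
  by (rule pi_fixes) simp

lemma pi_isnat: "isnat n \<Longrightarrow> \<pi> n = n"
  using isnat_cases[of n] by (auto intro: pi_fixes)

lemma pi_upr [simp]: "\<pi> (upr x y) = upr x y"
proof -
  have "upr x y \<noteq> pnt" using mem_pnt mem_upr nm_neq by metis
  moreover have "upr x y \<noteq> qnt" using mem_qnt mem_upr nm_neq pnt_neq by metis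
  ultimately show ?thesis by (simp add: \<pi>_def)
qed

lemma pi_opr [simp]: "\<pi> (opr x y) = opr x y"
  by (simp add: opr_def)

lemma pi_relation:
  assumes "\<And>z. z \<epsilon> r \<Longrightarrow> \<exists>x y. z = opr x y"
  shows "\<pi> r = r"
proof -
  \<comment> \<open>The only member of 1 is empty, whereas the members of a pair are
    nonempty.\<close>
  have "nm 1 \<noteq> opr x y" for x y
    using mem_nm(1)[of emp] mem_opr[of emp x y] mem_upr[of x x x] mem_upr[of x x y] mem_emp[of x]
    by metis
  then show ?thesis using assms by (intro pi_fixes) blast
qed

text \<open>If \<open>z\<close> has the wanted members for \<open>E\<close>, then
  \<open>\<pi> z\<close> has them for \<open>pm\<close>, since \<open>\<pi>\<close> is an
  involution.\<close>

lemma pm_set_ex: "\<exists>z. \<forall>w. w \<epsilon> z \<longleftrightarrow> B w \<Longrightarrow> \<exists>z. \<forall>w. pm w z \<longleftrightarrow> B w"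
  unfolding pm_def using ex_pi[of "\<lambda>z. \<forall>w. w \<epsilon> z \<longleftrightarrow> B w"] by simp

section \<open>Absoluteness of pairs, naturals and coded syntax\<close>

sublocale N: universe pm
proof
  show "x = y" if "\<And>z. pm z x \<longleftrightarrow> pm z y" for x y
    using that extensionality[of "\<pi> x" "\<pi> y"] by (simp add: pm_def)
  show "\<exists>z. \<forall>w. \<not> pm w z" using pm_set_ex[of "\<lambda>_. False"] empty_ex by simp
  show "\<exists>z. \<forall>w. pm w z \<longleftrightarrow> w = x \<or> w = y" for x y by (rule pm_set_ex[OF upair_ex])
  show "\<exists>z. \<forall>w. pm w z \<longleftrightarrow> pm w x \<or> w = y" for x y
    unfolding pm_def[of _ x] by (rule pm_set_ex[OF adjoin_ex])
qed

lemma eq_if_same_members: "(\<And>w. pm w x \<longleftrightarrow> w \<epsilon> y) \<Longrightarrow> \<pi> y = y \<Longrightarrow> x = y"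
  using extensionality[of "\<pi> x" y] by (metis pm_def pi_pi)

lemma pm_fixed: "\<pi> y = y \<Longrightarrow> pm x y \<longleftrightarrow> x \<epsilon> y"
  by (simp add: pm_def)

lemma N_emp: "N.emp = emp"
  by (rule eq_if_same_members) simp_all

lemma N_upr: "N.upr x y = upr x y"
  by (rule eq_if_same_members) simp_all

lemma N_opr: "N.opr x y = opr x y"
  by (simp add: N.opr_def opr_def N_upr)

lemma N_tup: "N.tup m u r i = tup m u r i"
  by (simp add: N.tup_def tup_def N_opr)

text \<open>The restriction matters: \<open>pnt\<close> is a member of itself for \<open>pm\<close>,
  so \<open>N.sc pnt = pnt\<close>. A natural and its successor are fixed points.\<close>

lemma N_sc: "isnat n \<Longrightarrow> N.sc n = sc n"
  by (rule eq_if_same_members) (simp_all add: pm_fixed pi_isnat isnat_sc)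

lemma N_nm: "N.nm k = nm k"
  by (induction k) (simp_all add: N_emp N_sc isnat_nm)

lemma N_codes:
  "N.varc x = varc x" "N.constc x = constc x" "N.eqc x y = eqc x y" "N.Uc x = Uc x"
  "N.Rc x y = Rc x y" "N.notc x = notc x" "N.andc x y = andc x y" "N.exc x = exc x"
  by (simp_all only: N.varc_def varc_def N.constc_def constc_def N.eqc_def eqc_def N.Uc_def Uc_def
    N.Rc_def Rc_def N.notc_def notc_def N.andc_def andc_def N.exc_def exc_def N_opr N_nm)

lemma N_isind_omega:
  assumes "\<And>n. n \<epsilon> w \<longleftrightarrow> isnat n"
  shows "N.isind (\<pi> w)"
  by (simp add: N.isind_def pm_def assms N_emp isnat_emp N_sc isnat_sc)

text \<open>The old set of naturals, read through \<open>\<pi>\<close>, is inductive for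
  \<open>pm\<close>. Conversely, an inductive \<open>v\<close> of the new model is first cut down to
  old naturals, since there the two successors agree.\<close>

lemma N_isnat: "N.isnat n \<longleftrightarrow> isnat n"
proof
  obtain w where w: "\<And>n. n \<epsilon> w \<longleftrightarrow> isnat n" using omega_ex by blast
  show "isnat n" if "N.isnat n"
  proof -
    have "pm n (\<pi> w)" using that N_isind_omega[OF w] unfolding N.isnat_def by blast
    then show ?thesis by (simp add: pm_def w)
  qed
  show "N.isnat n" if n: "isnat n"
    unfolding N.isnat_def
  proof (intro allI impI)
    fix v assume v: "N.isind v"
    have "\<exists>b. \<forall>x. x \<epsilon> b \<longleftrightarrow> x \<epsilon> \<pi> v \<and> isnat x"
      by (rule separation, rule means_is_nat)
    then obtain b where b: "\<And>x. x \<epsilon> b \<longleftrightarrow> x \<epsilon> \<pi> v \<and> isnat x" by blast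
    have "isind b"
      unfolding isind_def b
    proof (intro conjI allI impI; (elim conjE)?)
      show "emp \<epsilon> \<pi> v" using v by (simp add: N.isind_def pm_def N_emp)
      show "sc x \<epsilon> \<pi> v" if "x \<epsilon> \<pi> v" "isnat x" for x
        using v that N_sc[of x] by (auto simp: N.isind_def pm_def)
    qed (simp_all add: isnat_emp isnat_sc)
    then show "pm n v" using n b by (auto simp: isnat_def pm_def)
  qed
qed

lemma N_isfun: "N.isfun f a b \<longleftrightarrow> isfun (\<pi> f) (\<pi> a) (\<pi> b)"
  by (simp add: N.isfun_def isfun_def pm_def N_opr)

lemma pi_isfun: "isfun f a b \<Longrightarrow> \<pi> f = f"
  by (rule pi_relation) (auto simp: isfun_def)

text \<open>The domain and the function itself are fixed points; only the target has to be read
  through \<open>\<pi>\<close>.\<close>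

lemma N_isfun_assignment: "isnat n \<Longrightarrow> N.isfun e n m \<longleftrightarrow> isfun e n (\<pi> m)"
  unfolding N_isfun by (metis pi_isfun pi_isnat pi_pi)

lemma N_isterm: "isnat n \<Longrightarrow> N.isterm a n t \<longleftrightarrow> isterm (\<pi> a) n t"
  by (simp add: N.isterm_def isterm_def pm_def N_codes pi_isnat)

lemma N_isformclosed: "N.isformclosed a F \<longleftrightarrow> isformclosed (\<pi> a) (\<pi> F)"
  by (simp add: N.isformclosed_def isformclosed_def pm_def N_codes N_opr N_sc N_isnat N_isterm
    cong: imp_cong)

text \<open>Closed families of the two models correspond by \<open>\<pi>\<close>, while the pairs
  tested for membership are the same sets.\<close>

lemma N_isform: "N.isform a n p \<longleftrightarrow> isform (\<pi> a) n p"
  unfolding N.isform_def isform_def N_isformclosed N_isnat N_opr pm_def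
  using all_pi[of "\<lambda>F. isformclosed (\<pi> a) F \<longrightarrow> opr n p \<epsilon> F"] by simp

lemma N_isval: "N.isval i e t x \<longleftrightarrow> isval (\<pi> i) (\<pi> e) t x"
  by (simp add: N.isval_def isval_def pm_def N_codes N_opr)

text \<open>Adjunction is not absolute in general, but adding a pair to a relation gives a relation,
  and relations are fixed points.\<close>

lemma N_adj_assignment:
  assumes "isfun e n m"
  shows "N.adj e (opr k x) = adj e (opr k x)"
proof (rule eq_if_same_members)
  show "pm w (N.adj e (opr k x)) \<longleftrightarrow> w \<epsilon> adj e (opr k x)" for w
    by (simp add: pm_fixed pi_isfun[OF assms])
  show "\<pi> (adj e (opr k x)) = adj e (opr k x)"
    using assms by (intro pi_relation) (auto simp: isfun_def)
qed

lemma N_issatrel: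
  "N.issatrel a m u r i S \<longleftrightarrow> issatrel (\<pi> a) (\<pi> m) (\<pi> u) (\<pi> r) (\<pi> i) (\<pi> S)"
  unfolding N.issatrel_def issatrel_def
proof (intro iff_allI)
  fix n e
  show "(N.isnat n \<and> N.isfun e n m \<longrightarrow>
     (\<forall>s t. N.isterm a n s \<and> N.isterm a n t \<longrightarrow>
        (pm (N.opr (N.eqc s t) e) S \<longleftrightarrow> (\<exists>x. N.isval i e s x \<and> N.isval i e t x))) \<and>
     (\<forall>t. N.isterm a n t \<longrightarrow>
        (pm (N.opr (N.Uc t) e) S \<longleftrightarrow> (\<exists>x. N.isval i e t x \<and> pm x u))) \<and>
     (\<forall>s t. N.isterm a n s \<and> N.isterm a n t \<longrightarrow>
        (pm (N.opr (N.Rc s t) e) S \<longleftrightarrow>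
          (\<exists>x y. N.isval i e s x \<and> N.isval i e t y \<and> pm (N.opr x y) r))) \<and>
     (\<forall>p. N.isform a n p \<longrightarrow>
        (pm (N.opr (N.notc p) e) S \<longleftrightarrow> \<not> pm (N.opr p e) S)) \<and>
     (\<forall>p q. N.isform a n p \<and> N.isform a n q \<longrightarrow>
        (pm (N.opr (N.andc p q) e) S \<longleftrightarrow> pm (N.opr p e) S \<and> pm (N.opr q e) S)) \<and>
     (\<forall>p. N.isform a (N.sc n) p \<longrightarrow>
        (pm (N.opr (N.exc p) e) S \<longleftrightarrow>
          (\<exists>x. pm x m \<and> pm (N.opr p (N.adj e (N.opr n x))) S)))) \<longleftrightarrow>
    (isnat n \<and> isfun e n (\<pi> m) \<longrightarrow>
     (\<forall>s t. isterm (\<pi> a) n s \<and> isterm (\<pi> a) n t \<longrightarrow>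
        (opr (eqc s t) e \<epsilon> \<pi> S \<longleftrightarrow> (\<exists>x. isval (\<pi> i) e s x \<and> isval (\<pi> i) e t x))) \<and>
     (\<forall>t. isterm (\<pi> a) n t \<longrightarrow>
        (opr (Uc t) e \<epsilon> \<pi> S \<longleftrightarrow> (\<exists>x. isval (\<pi> i) e t x \<and> x \<epsilon> \<pi> u))) \<and>
     (\<forall>s t. isterm (\<pi> a) n s \<and> isterm (\<pi> a) n t \<longrightarrow>
        (opr (Rc s t) e \<epsilon> \<pi> S \<longleftrightarrow>
          (\<exists>x y. isval (\<pi> i) e s x \<and> isval (\<pi> i) e t y \<and> opr x y \<epsilon> \<pi> r))) \<and>
     (\<forall>p. isform (\<pi> a) n p \<longrightarrow>
        (opr (notc p) e \<epsilon> \<pi> S \<longleftrightarrow> \<not> opr p e \<epsilon> \<pi> S)) \<and>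
     (\<forall>p q. isform (\<pi> a) n p \<and> isform (\<pi> a) n q \<longrightarrow>
        (opr (andc p q) e \<epsilon> \<pi> S \<longleftrightarrow> opr p e \<epsilon> \<pi> S \<and> opr q e \<epsilon> \<pi> S)) \<and>
     (\<forall>p. isform (\<pi> a) (sc n) p \<longrightarrow>
        (opr (exc p) e \<epsilon> \<pi> S \<longleftrightarrow>
          (\<exists>x. x \<epsilon> \<pi> m \<and> opr p (adj e (opr n x)) \<epsilon> \<pi> S))))"
  \<comment> \<open>Outside the guard both sides hold trivially. Within it \<open>n\<close> is a
    natural and \<open>e\<close> an assignment, which are the conditions for rewriting to the old
    notions.\<close>
  proof (cases "isnat n \<and> isfun e n (\<pi> m)")
    case True
    then have "\<pi> e = e" "\<And>x. N.adj e (opr n x) = adj e (opr n x)"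
      using pi_isfun N_adj_assignment by blast+
    with True show ?thesis
      by (simp add: N_isnat N_isfun_assignment N_isterm N_codes N_opr N_isval N_isform N_sc
        pm_def)
  next
    case False
    then show ?thesis by (auto simp: N_isnat N_isfun_assignment)
  qed
qed

lemma N_sats: "N.sats a m u r i p e \<longleftrightarrow> sats (\<pi> a) (\<pi> m) (\<pi> u) (\<pi> r) (\<pi> i) p e"
  unfolding N.sats_def sats_def N_issatrel N_opr pm_def
  by (rule ex_pi[of "\<lambda>S. issatrel (\<pi> a) (\<pi> m) (\<pi> u) (\<pi> r) (\<pi> i) S \<and> opr p e \<epsilon> S"])

lemma N_in_comp: "N.in_comp f e w \<longleftrightarrow> in_comp (\<pi> f) (\<pi> e) w"
  by (simp add: N.in_comp_def in_comp_def pm_def N_opr)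

sublocale N: universe_comp pm
  by unfold_locales (simp add: N_in_comp pm_set_ex comp_ex)

lemma N_comp: "N.comp f e = comp (\<pi> f) (\<pi> e)"
  by (rule eq_if_same_members)
     (auto simp: N.mem_comp mem_comp N_in_comp in_comp_def intro!: pi_relation)

lemma N_isstruct:
  "N.isstruct a (tup m u r i) \<longleftrightarrow> isstruct (\<pi> a) (tup (\<pi> m) (\<pi> u) (\<pi> r) (\<pi> i))"
  by (simp add: N.isstruct_def isstruct_def N_tup N_isfun pm_def N_opr)

text \<open>Codes and assignments are the same sets in both models and satisfaction corresponds by
  reading the components through \<open>\<pi>\<close>. Although \<open>f\<close>, being a relation,
  equals \<open>\<pi> f\<close>, the form \<open>\<pi> f\<close> lets \<open>N_isfun\<close> cancel
  the permutation.\<close>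

lemma N_iselem:
  assumes "iselem (\<pi> a) f (tup (\<pi> m) (\<pi> u) (\<pi> r) (\<pi> i)) (tup (\<pi> m') (\<pi> u') (\<pi> r') (\<pi> i'))"
  shows "N.iselem a (\<pi> f) (tup m u r i) (tup m' u' r' i')"
proof -
  have f: "isfun f (\<pi> m) (\<pi> m')"
    and sats: "\<And>n p e. isform (\<pi> a) n p \<Longrightarrow> isfun e n (\<pi> m) \<Longrightarrow>
       (sats (\<pi> a) (\<pi> m) (\<pi> u) (\<pi> r) (\<pi> i) p e \<longleftrightarrow>
        sats (\<pi> a) (\<pi> m') (\<pi> u') (\<pi> r') (\<pi> i') p (comp f e))"
    using assms by (auto simp: iselem_def)
  have "N.sats a m u r i p e \<longleftrightarrow> N.sats a m' u' r' i' p (N.comp (\<pi> f) e)"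
    if "N.isform a n p" "N.isfun e n m" for n p e
  proof -
    have "isform (\<pi> a) n p" using that(1) by (simp add: N_isform)
    moreover from this have "isfun e n (\<pi> m)"
      using that(2) N_isfun_assignment by (simp add: isform_def)
    ultimately show ?thesis using sats[of n p e] by (simp add: N_sats N_comp pi_isfun)
  qed
  then show ?thesis
    unfolding N.iselem_def N_tup using f by (auto simp: N_isfun)
qed


text \<open>\<open>tr k\<close> expresses \<open>pm\<close> by \<open>E\<close>; the indices \<open>k\<close> and \<open>k + 1\<close> are inserted for \<open>pnt\<close> and \<open>qnt\<close>.\<close>

primrec tr :: "nat \<Rightarrow> fm \<Rightarrow> fm" where
  "tr k (Eq i j) = Eq (if i < k then i else i + 2) (if j < k then j else j + 2)"
| "tr k (Mem i j) = (let s = if i < k then i else i + 2; t = if j < k then j else j + 2;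
      p = k; q = Suc k in
    Ite (Eq t p) (Mem s q) (Ite (Eq t q) (Mem s p) (Mem s t)))"
| "tr k Fls = Fls"
| "tr k (Imp p q) = Imp (tr k p) (tr k q)"
| "tr k (All p) = All (tr (Suc k) p)"

lemma sat_tr:
  "\<rho> k = pnt \<Longrightarrow> \<rho> (Suc k) = qnt \<Longrightarrow>
    sat UNIV E \<rho> (tr k p) \<longleftrightarrow> sat UNIV pm (\<lambda>i. \<rho> (if i < k then i else i + 2)) p"
proof (induction p arbitrary: k \<rho>)
  case (Mem i j)
  then show ?case by (simp add: Let_def sat_Ite pm_def \<pi>_def)
next
  case (All p)
  have "(\<lambda>i. case_nat x \<rho> (if i < Suc k then i else i + 2)) =
      case_nat x (\<lambda>i. \<rho> (if i < k then i else i + 2))" for x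
    by (auto simp: fun_eq_iff split: nat.split)
  then show ?case using All.prems by (simp add: All.IH)
qed auto

lemma sat_tr1:
  "sat UNIV E (case_nat x (case_nat pnt (case_nat qnt par))) (tr 1 p) \<longleftrightarrow>
    sat UNIV pm (case_nat x par) p"
proof -
  have "(\<lambda>i. case_nat x (case_nat pnt (case_nat qnt par)) (if i < 1 then i else i + 2)) = case_nat x par"
    by (auto simp: fun_eq_iff split: nat.split)
  then show ?thesis by (subst sat_tr) simp_all
qed

lemma sat_tr2:
  "sat UNIV E (case_nat x (case_nat y (case_nat pnt (case_nat qnt par)))) (tr 2 p) \<longleftrightarrow>
    sat UNIV pm (case_nat x (case_nat y par)) p"
proof -
  have "(\<lambda>i. case_nat x (case_nat y (case_nat pnt (case_nat qnt par))) (if i < 2 then i else i + 2)) =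
      case_nat x (case_nat y par)"
    by (auto simp: fun_eq_iff less_Suc_eq numeral_2_eq_2 split: nat.split)
  then show ?thesis by (subst sat_tr) (simp_all add: numeral_2_eq_2)
qed

section \<open>Translating classes of structures\<close>

text \<open>The graph of \<open>\<pi>\<close> is thus definable from the two points, which allows
  \<open>\<pi>\<close> to occur in instances of the schemes.\<close>

lemma means_pi:
  assumes "denotes E par c (Var 0) pnt" "denotes E par c (Var 1) qnt"
    and "denotes E par c s x" "denotes E par c t y"
  shows "means E par c (s \<^bold>= Var 0 \<^bold>\<and> t \<^bold>= Var 1 \<^bold>\<or> s \<^bold>= Var 1 \<^bold>\<and> t \<^bold>= Var 0 \<^bold>\<or>
      \<^bold>\<not> s \<^bold>= Var 0 \<^bold>\<and> \<^bold>\<not> s \<^bold>= Var 1 \<^bold>\<and> s \<^bold>= t) (y = \<pi> x)"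
proof -
  have "means E par c (s \<^bold>= Var 0 \<^bold>\<and> t \<^bold>= Var 1 \<^bold>\<or> s \<^bold>= Var 1 \<^bold>\<and> t \<^bold>= Var 0 \<^bold>\<or>
      \<^bold>\<not> s \<^bold>= Var 0 \<^bold>\<and> \<^bold>\<not> s \<^bold>= Var 1 \<^bold>\<and> s \<^bold>= t)
    (x = pnt \<and> y = qnt \<or> x = qnt \<and> y = pnt \<or> \<not> x = pnt \<and> \<not> x = qnt \<and> x = y)"
    by (intro means_logic assms)
  moreover have "(x = pnt \<and> y = qnt \<or> x = qnt \<and> y = pnt \<or> \<not> x = pnt \<and> \<not> x = qnt \<and> x = y) \<longleftrightarrow> y = \<pi> x"
    using pnt_neq(4) by (auto simp: \<pi>_def)
  ultimately show ?thesis by simp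
qed

text \<open>Its graph has to be written as a form; hence a relation on 4-tuples in which the primed
  components are separate quantified sets tied to the others by the graph of
  \<open>\<pi>\<close>.\<close>

definition star :: "'a \<Rightarrow> 'a \<Rightarrow> bool" where
  "star s t \<longleftrightarrow> (\<exists>m u r i m' u' r' i'. s = tup m u r i \<and> t = tup m' u' r' i' \<and>
     m' = \<pi> m \<and> u' = \<pi> u \<and> r' = \<pi> r \<and> i' = \<pi> i)"

lemma means_star:
  assumes "denotes E par c (Var 0) pnt" "denotes E par c (Var 1) qnt"
  obtains F where "\<And>c' s t x y. c \<preceq> c' \<Longrightarrow> denotes E par c' s x \<Longrightarrow> denotes E par c' t y \<Longrightarrow>
    means E par c' (F s t) (star x y)"
proof -
  define G where "G s t = (s \<^bold>= Var 0 \<^bold>\<and> t \<^bold>= Var 1 \<^bold>\<or> s \<^bold>= Var 1 \<^bold>\<and> t \<^bold>= Var 0 \<^bold>\<or>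
      \<^bold>\<not> s \<^bold>= Var 0 \<^bold>\<and> \<^bold>\<not> s \<^bold>= Var 1 \<^bold>\<and> s \<^bold>= t)" for s t
  define F where "F s t = (\<^bold>\<exists>m. \<^bold>\<exists>u. \<^bold>\<exists>r. \<^bold>\<exists>i. \<^bold>\<exists>m'. \<^bold>\<exists>u'. \<^bold>\<exists>r'. \<^bold>\<exists>i'.
    s \<^bold>= tuple4 m u r i \<^bold>\<and> t \<^bold>= tuple4 m' u' r' i' \<^bold>\<and> G m m' \<^bold>\<and> G u u' \<^bold>\<and> G r r' \<^bold>\<and> G i i')" for s t
  have "means E par c' (F s t) (star x y)"
    if c': "c \<preceq> c'" and d: "denotes E par c' s x" "denotes E par c' t y" for c' s t x y
  proof -
    have G: "means E par c'' (G s t) (y = \<pi> x)"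
      if "denotes E par c'' (Var 0) pnt" "denotes E par c'' (Var 1) qnt"
        "denotes E par c'' s x" "denotes E par c'' t y" for c'' s t x y
      unfolding G_def using that by (rule means_pi)
    note p = denotes_mono[OF c' assms(1)] and q = denotes_mono[OF c' assms(2)]
    show ?thesis
      unfolding F_def star_def using d p q
      by - (rule means_logic(1-10) G | assumption | rule denotes_terms
          | (rule denotes_mono, assumption))+
  qed
  then show thesis by (rule that)
qed

lemma star_cases:
  assumes "star s t"
  obtains m u r i where "s = tup m u r i" "t = tup (\<pi> m) (\<pi> u) (\<pi> r) (\<pi> i)"
  using assms by (auto simp: star_def)

lemma star_fun: "star s t \<Longrightarrow> star s t' \<Longrightarrow> t = t'"
  by (auto simp: star_def)

lemma star_inj: "star s t \<Longrightarrow> star s' t \<Longrightarrow> s = s'"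
  by (auto simp: star_def)

lemma N_structure_star: "N.isstruct a s \<Longrightarrow> \<exists>t. star s t"
  by (auto simp: N.isstruct_def star_def N_tup)

lemma star_isstruct: "star s t \<Longrightarrow> N.isstruct a s \<Longrightarrow> isstruct (\<pi> a) t"
  by (elim star_cases) (simp add: N_isstruct)

text \<open>VP is applied in \<open>E\<close> to the image \<open>Y\<close> of the class under
  \<open>star\<close>. As \<open>star\<close> is injective and total on structures of the new model,
  \<open>Y\<close> is proper; as it is functional, distinct structures in \<open>Y\<close> come from
  distinct ones in \<open>X\<close>.\<close>

lemma N_Vopenka:
  assumes VP: "\<And>p \<rho>. sat UNIV E \<rho> (Vopenka p)"
  shows "sat UNIV pm \<rho> (Vopenka p)"
proof -
  have "N.Vopenka_for (\<lambda>x. sat UNIV pm (case_nat x par) p)" for par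
    unfolding N.Vopenka_for_def
  proof (intro allI impI, elim conjE)
    fix a
    define X where "X x \<longleftrightarrow> sat UNIV pm (case_nat x par) p" for x
    assume "\<forall>x. \<exists>y. sat UNIV pm (case_nat y par) p \<and> \<not> pm y x \<or> \<not> sat UNIV pm (case_nat y par) p \<and> pm y x"
      and "\<forall>x. sat UNIV pm (case_nat x par) p \<longrightarrow> N.isstruct a x"
    then have proper: "\<not> (\<forall>y. X y \<longleftrightarrow> pm y x)" and str: "X x \<Longrightarrow> N.isstruct a x" for x
      unfolding X_def by blast+
    define Y where "Y y \<longleftrightarrow> (\<exists>x. X x \<and> star x y)" for y
    define par' where "par' = case_nat pnt (case_nat qnt par)"
    obtain c where c: "denotes E par' c (Var 0) pnt" "denotes E par' c (Var 1) qnt"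
      by (rule context_with_two_values)
    obtain F where F: "\<And>c' s t x y. c \<preceq> c' \<Longrightarrow> denotes E par' c' s x \<Longrightarrow> denotes E par' c' t y \<Longrightarrow>
        means E par' c' (F s t) (star x y)"
      by (rule means_star[OF c]) blast
    \<comment> \<open>The swapped points enter twice: as parameters in \<open>par'\<close> for the
      formula \<open>tr 1 p\<close>, and as levels 0 and 1 of \<open>c\<close> for the form of
      \<open>star\<close>.\<close>
    have def_Y: "means E par' c' (\<^bold>\<exists>s. app1 (tr 1 p) s \<^bold>\<and> F s t) (Y y)"
      if c': "c \<preceq> c'" and t: "denotes E par' c' t y" for c' t y
      unfolding Y_def X_def sat_tr1[symmetric] par'_def[symmetric]
      by (intro means_Ex means_And means_app1 F)
        (auto intro: extends_trans[OF c'] denotes_mono[OF _ t])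
    have "\<exists>p par2. \<forall>y. sat UNIV E (case_nat y par2) p \<longleftrightarrow> Y y"
      by (rule definable_by_formula) (rule def_Y)
    then obtain p2 par2 where Y: "\<forall>y. sat UNIV E (case_nat y par2) p2 \<longleftrightarrow> Y y" by blast
    have "Vopenka_for Y"
    proof -
      have "(\<lambda>y. sat UNIV E (case_nat y par2) p2) = Y" using Y by blast
      then show ?thesis using VP[of _ p2] sat_Vopenka[of p2] by metis
    qed
    moreover have "\<exists>y. Y y \<and> \<not> y \<epsilon> b \<or> \<not> Y y \<and> y \<epsilon> b" for b
    proof (rule ccontr)
      assume "\<nexists>y. Y y \<and> \<not> y \<epsilon> b \<or> \<not> Y y \<and> y \<epsilon> b"
      then have b: "y \<epsilon> b \<longleftrightarrow> Y y" for y by blast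
      \<comment> \<open>Replacement runs along \<open>star\<close> backwards, with
        \<open>star_inj\<close> as functionality. Were \<open>Y\<close> a set \<open>b\<close>, its
        sources would form a set \<open>d\<close>, and \<open>\<pi> d\<close> would be the class
        \<open>X\<close> as a set of the new model.\<close>
      have "\<exists>d. \<forall>x. x \<epsilon> d \<longleftrightarrow> (\<exists>y. y \<epsilon> b \<and> star x y)"
        by (rule replacement[where c = c and par = par' and F = "\<lambda>s t. F t s"])
          (auto intro: F star_inj)
      then obtain d where d: "\<And>x. x \<epsilon> d \<longleftrightarrow> (\<exists>y. Y y \<and> star x y)" by (auto simp: b)
      have "x \<epsilon> d \<longleftrightarrow> X x" for x
        unfolding d Y_def using star_inj N_structure_star[OF str] by blast
      then show False using proper[of "\<pi> d"] by (simp add: pm_def)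
    qed
    moreover have "Y y \<Longrightarrow> isstruct (\<pi> a) y" for y
      unfolding Y_def using star_isstruct str by blast
    ultimately obtain M N f where MN: "Y M" "Y N" "M \<noteq> N" "iselem (\<pi> a) f M N"
      unfolding Vopenka_for_def by metis
    then obtain M' N' where M': "X M'" "star M' M" and N': "X N'" "star N' N"
      by (auto simp: Y_def)
    have "N.iselem a (\<pi> f) M' N'"
      using M'(2) N'(2) MN(4) by (elim star_cases) (auto intro: N_iselem)
    moreover have "M' \<noteq> N'" using M'(2) N'(2) MN(3) star_fun by blast
    ultimately show "\<exists>M N. sat UNIV pm (case_nat M par) p \<and> sat UNIV pm (case_nat N par) p \<and> \<not> M = N \<and>
        (\<exists>f. N.iselem a f M N)"
      using M'(1) N'(1) unfolding X_def by blast
  qed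
  then show ?thesis using N.sat_Vopenka by blast
qed

section \<open>The axioms of set theory in the permutation model\<close>

text \<open>Membership for \<open>pm\<close> applies \<open>\<pi>\<close> to the set on the right;
  where the members of a set are themselves read as sets, \<open>\<pi>\<close> has to be applied to
  each of them.\<close>

lemma pi_image: "\<exists>b. \<forall>y. y \<epsilon> b \<longleftrightarrow> \<pi> y \<epsilon> a"
proof -
  obtain c where c: "denotes E undefined c (Var 0) pnt" "denotes E undefined c (Var 1) qnt"
    by (rule context_with_two_values)
  have "\<exists>b. \<forall>y. y \<epsilon> b \<longleftrightarrow> (\<exists>x. x \<epsilon> a \<and> y = \<pi> x)"
    by (rule replacement[where c = c], rule means_pi)
       (rule c | assumption | (rule denotes_mono, assumption) | simp)+
  then show ?thesis by (metis pi_pi)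
qed

lemma N_ZF0:
  assumes "p \<in> ZF0"
  shows "sat UNIV pm \<rho> p"
proof -
  have "\<forall>\<rho>. sat UNIV pm \<rho> Extensionality"
    unfolding sat_Extensionality using N.extensionality by blast
  moreover have "\<forall>\<rho>. sat UNIV pm \<rho> Pairing"
    unfolding sat_Pairing using N.upair_ex by blast
  moreover have "\<forall>\<rho>. sat UNIV pm \<rho> Union_ax"
    unfolding sat_Union_ax
  proof
    fix x
    \<comment> \<open>\<open>v\<close> consists of the members of \<open>\<pi> x\<close>, each
      replaced by its image under \<open>\<pi>\<close>; its union for \<open>E\<close> has the
      members required of the union for \<open>pm\<close>.\<close>
    obtain v where v: "\<And>y. y \<epsilon> v \<longleftrightarrow> \<pi> y \<epsilon> \<pi> x" using pi_image by blast
    obtain u where "\<And>z. z \<epsilon> u \<longleftrightarrow> (\<exists>y. y \<epsilon> v \<and> z \<epsilon> y)" using union by metis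
    then have "z \<epsilon> u \<longleftrightarrow> (\<exists>y. y \<epsilon> \<pi> x \<and> z \<epsilon> \<pi> y)" for z
      unfolding v using ex_pi[of "\<lambda>y. y \<epsilon> \<pi> x \<and> z \<epsilon> \<pi> y"] by simp
    then show "\<exists>u. \<forall>z. pm z u \<longleftrightarrow> (\<exists>y. pm y x \<and> pm z y)"
      by (intro exI[of _ "\<pi> u"]) (simp add: pm_def)
  qed
  moreover have "\<forall>\<rho>. sat UNIV pm \<rho> Power_set"
    unfolding sat_Power_set
  proof
    fix x
    obtain v where v: "\<And>y. y \<epsilon> v \<longleftrightarrow> (\<forall>z. z \<epsilon> y \<longrightarrow> z \<epsilon> \<pi> x)" using power by metis
    obtain u where "\<And>y. y \<epsilon> u \<longleftrightarrow> \<pi> y \<epsilon> v" using pi_image by blast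
    then show "\<exists>p. \<forall>y. pm y p \<longleftrightarrow> (\<forall>z. pm z y \<longrightarrow> pm z x)"
      by (intro exI[of _ "\<pi> u"]) (simp add: pm_def v)
  qed
  moreover have "\<forall>\<rho>. sat UNIV pm \<rho> Infinity"
    unfolding N.sat_Infinity using omega_ex N_isind_omega by blast
  moreover have "\<forall>\<rho>. sat UNIV pm \<rho> (Separation q)" for q
    unfolding sat_Separation
  proof (intro allI)
    fix par :: "nat \<Rightarrow> 'a" and a
    \<comment> \<open>The instance for \<open>q\<close> over \<open>pm\<close> comes from the
      instance for \<open>tr 1 q\<close> over \<open>E\<close>, with the swapped points prepended to
      the parameters.\<close>
    obtain b where "\<And>x. x \<epsilon> b \<longleftrightarrow> x \<epsilon> \<pi> a \<and> sat UNIV pm (case_nat x par) q"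
      using sat_ZF0_axioms(6)[of "tr 1 q", unfolded sat_Separation, rule_format,
        of "\<pi> a" "case_nat pnt (case_nat qnt par)", unfolded sat_tr1] by blast
    then show "\<exists>b. \<forall>x. pm x b \<longleftrightarrow> pm x a \<and> sat UNIV pm (case_nat x par) q"
      by (intro exI[of _ "\<pi> b"]) (simp add: pm_def)
  qed
  moreover have "\<forall>\<rho>. sat UNIV pm \<rho> (Replacement q)" for q
    unfolding sat_Replacement
  proof (intro allI impI)
    fix par :: "nat \<Rightarrow> 'a" and a
    assume "\<forall>x y z. sat UNIV pm (case_nat x (case_nat y par)) q \<and>
      sat UNIV pm (case_nat x (case_nat z par)) q \<longrightarrow> y = z"
    then obtain b where "\<And>y. y \<epsilon> b \<longleftrightarrow> (\<exists>x. x \<epsilon> \<pi> a \<and> sat UNIV pm (case_nat x (case_nat y par)) q)"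
      using sat_ZF0_axioms(7)[of "tr 2 q", unfolded sat_Replacement, THEN spec,
        of "case_nat pnt (case_nat qnt par)", unfolded sat_tr2] by blast
    then show "\<exists>b. \<forall>y. pm y b \<longleftrightarrow> (\<exists>x. pm x a \<and> sat UNIV pm (case_nat x (case_nat y par)) q)"
      by (intro exI[of _ "\<pi> b"]) (simp add: pm_def)
  qed
  ultimately show ?thesis using assms unfolding ZF0_def by blast
qed

lemma N_Choice:
  assumes "\<And>\<rho>. sat UNIV E \<rho> Choice"
  shows "sat UNIV pm \<rho> Choice"
proof -
  have "\<forall>\<rho>. sat UNIV pm \<rho> Choice"
    unfolding N.sat_Choice
  proof (intro allI impI)
    fix a assume ne: "\<forall>x. pm x a \<longrightarrow> (\<exists>y. pm y x)"
    \<comment> \<open>\<open>a'\<close> holds the members of \<open>a\<close> as their extents in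
      \<open>E\<close>, so a choice from \<open>a'\<close> picks members for
      \<open>pm\<close>.\<close>
    obtain a' where a': "\<And>y. y \<epsilon> a' \<longleftrightarrow> \<pi> y \<epsilon> \<pi> a" using pi_image by blast
    have "\<exists>y. y \<epsilon> x" if "x \<epsilon> a'" for x
      using ne[rule_format, of "\<pi> x"] that by (simp add: pm_def a')
    then obtain f b where f: "isfun f a' b" and sel: "\<And>x y. opr x y \<epsilon> f \<Longrightarrow> y \<epsilon> x"
      using assms sat_Choice by blast
    obtain c where c: "denotes E undefined c (Var 0) pnt" "denotes E undefined c (Var 1) qnt"
      by (rule context_with_two_values)
    \<comment> \<open>Each argument of \<open>f\<close> is the extent of a member of
      \<open>a\<close>; \<open>g\<close> puts that member back as argument and keeps the chosen
      value.\<close>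
    have "\<exists>g. \<forall>w. w \<epsilon> g \<longleftrightarrow> (\<exists>z. z \<epsilon> f \<and> (\<exists>x y x'. z = opr x y \<and> w = opr x' y \<and> x' = \<pi> x))"
    proof (rule replacement[where c = c and par = undefined])
      fix c' s t z w
      assume c': "c \<preceq> c'" and d: "denotes E undefined c' s z" "denotes E undefined c' t w"
      note p = denotes_mono[OF c' c(1)] and q = denotes_mono[OF c' c(2)]
      show "means E undefined c' (\<^bold>\<exists>x. \<^bold>\<exists>y. \<^bold>\<exists>x'. s \<^bold>= \<langle>x, y\<rangle> \<^bold>\<and> t \<^bold>= \<langle>x', y\<rangle> \<^bold>\<and>
          (x \<^bold>= Var 0 \<^bold>\<and> x' \<^bold>= Var 1 \<^bold>\<or> x \<^bold>= Var 1 \<^bold>\<and> x' \<^bold>= Var 0 \<^bold>\<or>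
            \<^bold>\<not> x \<^bold>= Var 0 \<^bold>\<and> \<^bold>\<not> x \<^bold>= Var 1 \<^bold>\<and> x \<^bold>= x'))
        (\<exists>x y x'. z = opr x y \<and> w = opr x' y \<and> x' = \<pi> x)"
        using d p q
        by - (rule means_pi means_And means_Ex means_Eq | assumption | rule denotes_terms
            | (rule denotes_mono, assumption))+
    qed auto
    then obtain g where g: "\<And>w. w \<epsilon> g \<longleftrightarrow> (\<exists>x y. opr x y \<epsilon> f \<and> w = opr (\<pi> x) y)" by blast
    have g_opr: "opr x y \<epsilon> g \<longleftrightarrow> opr (\<pi> x) y \<epsilon> f" for x y
      unfolding g by (metis opr_eq_iff pi_pi)
    have "isfun g (\<pi> a) b"
      unfolding isfun_def
    proof (intro conjI allI impI)
      fix z assume "z \<epsilon> g"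
      then obtain x y where xy: "opr x y \<epsilon> f" "z = opr (\<pi> x) y" unfolding g by blast
      then have "x \<epsilon> a'" "y \<epsilon> b" using f unfolding isfun_def by (metis opr_eq_iff)+
      then show "\<exists>x y. x \<epsilon> \<pi> a \<and> y \<epsilon> b \<and> z = opr x y" using xy(2) a' by blast
    next
      fix x assume "x \<epsilon> \<pi> a"
      then have "\<pi> x \<epsilon> a'" by (simp add: a')
      then show "\<exists>y. opr x y \<epsilon> g \<and> (\<forall>y'. opr x y' \<epsilon> g \<longrightarrow> y' = y)"
        using f unfolding g_opr isfun_def by blast
    qed
    then have "N.isfun (\<pi> g) a (\<pi> b)" by (simp add: N_isfun)
    moreover have "pm y x" if "pm (N.opr x y) (\<pi> g)" for x y
      using that sel by (simp add: pm_def N_opr g_opr)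
    ultimately show "\<exists>f b. N.isfun f a b \<and> (\<forall>x y. pm (N.opr x y) f \<longrightarrow> pm y x)" by blast
  qed
  then show ?thesis by blast
qed

lemma N_not_Foundation: "\<not> (\<forall>\<rho>. sat UNIV pm \<rho> Foundation)"
proof -
  have "pm pnt pnt" by (simp add: pm_def \<pi>_def mem_qnt)
  then have "\<exists>y. pm y (N.upr pnt pnt)" "\<forall>y. pm y (N.upr pnt pnt) \<longrightarrow> (\<exists>z. pm z (N.upr pnt pnt) \<and> pm z y)"
    by auto
  then show ?thesis unfolding sat_Foundation by blast
qed

end

section \<open>Relative consistency\<close>

text \<open>Lifts the failure of Foundation at one valuation to all valuations, as soundness demands
  of its negation.\<close>

lemma sat_sentence:
  assumes "fv_bound p = 0"
  shows "sat UNIV E \<rho> p \<longleftrightarrow> sat UNIV E \<sigma> p"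
proof -
  \<comment> \<open>Interleaving makes both valuations renamings of \<open>\<tau>\<close>, and
    renaming leaves a sentence as it is.\<close>
  define \<tau> where "\<tau> i = (if even i then \<rho> (i div 2) else \<sigma> (i div 2))" for i
  have "(\<lambda>i. \<tau> (2 * i)) = \<rho>" "(\<lambda>i. \<tau> (2 * i + 1)) = \<sigma>"
    by (simp_all add: \<tau>_def fun_eq_iff)
  then have "sat UNIV E \<rho> p \<longleftrightarrow> sat UNIV E \<tau> p" "sat UNIV E \<sigma> p \<longleftrightarrow> sat UNIV E \<tau> p"
    using sat_ren[of UNIV E \<tau> "\<lambda>i. 2 * i" p] sat_ren[of UNIV E \<tau> "\<lambda>i. 2 * i + 1" p]
    by (simp_all only: ren_sentence[OF assms])
  then show ?thesis by simp
qed

lemma fv_bound_axioms: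
  assumes "p \<in> ZFC \<union> VP"
  shows "fv_bound p = 0"
  using assms by (auto simp: ZFC_def ZFC0_def ZF0_def VP_def Extensionality_def Pairing_def Union_ax_def
    Power_set_def Infinity_def Separation_def Replacement_def Choice_def Foundation_def Vopenka_def
    fv_bound_univ_closure)

text \<open>\<open>S\<close> is empty or consists of Choice, so one argument gives both
  implications: Choice is passed on when \<open>T\<close> contains it.\<close>

lemma relative_consistency:
  assumes "consistent T" and T: "ZF0 \<union> VP \<subseteq> T" "T \<subseteq> ZFC \<union> VP"
    and S: "S \<subseteq> T \<inter> {Choice}"
  shows "consistent (ZF0 \<union> VP \<union> {Imp Foundation Fls} \<union> S)"
proof -
  have "\<exists>E :: nat \<Rightarrow> nat \<Rightarrow> bool. \<forall>p\<in>T. \<forall>\<rho>. sat UNIV E \<rho> p"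
  proof (rule model_of_consistent_set_theory[OF assms(1)])
    show "fv_bound p = 0" if "p \<in> T" for p using that T(2) by (intro fv_bound_axioms) blast
    show "ZF0 \<subseteq> T" using T(1) by simp
  qed
  then obtain E :: "nat \<Rightarrow> nat \<Rightarrow> bool" where E: "\<forall>p\<in>T. \<forall>\<rho>. sat UNIV E \<rho> p" ..
  interpret zf0_model E
    using E T(1) by unfold_locales blast
  have "\<not> sat UNIV pm \<rho> Foundation" for \<rho>
    using N_not_Foundation sat_sentence[OF fv_bound_axioms, of Foundation] by (auto simp: ZFC_def)
  moreover have "sat UNIV pm \<rho> p" if "p \<in> VP" for p \<rho>
    using that E T(1) N_Vopenka unfolding VP_def by blast
  moreover have "sat UNIV pm \<rho> p" if "p \<in> S" for p \<rho>
    using that E S N_Choice by blast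
  ultimately have *: "sat UNIV pm \<rho> p" if "p \<in> ZF0 \<union> VP \<union> {Imp Foundation Fls} \<union> S" for p \<rho>
    using that N_ZF0 by auto
  show ?thesis
    unfolding consistent_def using soundness[OF _ *] by fastforce
qed

theorem theorem3p1:
  shows "(consistent (ZF \<union> VP) \<longrightarrow> consistent (ZF0 \<union> VP \<union> {Imp Foundation Fls})) \<and>
         (consistent (ZFC \<union> VP) \<longrightarrow> consistent (ZFC0 \<union> VP \<union> {Imp Foundation Fls}))"
proof (intro conjI impI)
  assume "consistent (ZF \<union> VP)"
  then show "consistent (ZF0 \<union> VP \<union> {Imp Foundation Fls})"
    using relative_consistency[of "ZF \<union> VP" "{}"] by (auto simp: ZF_def ZFC_def ZFC0_def)
next
  assume "consistent (ZFC \<union> VP)"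
  moreover have "ZFC0 \<union> VP \<union> {Imp Foundation Fls} = ZF0 \<union> VP \<union> {Imp Foundation Fls} \<union> {Choice}"
    by (auto simp: ZFC0_def)
  ultimately show "consistent (ZFC0 \<union> VP \<union> {Imp Foundation Fls})"
    using relative_consistency[of "ZFC \<union> VP" "{Choice}"] by (simp add: ZFC_def ZFC0_def) blast
qed

end
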